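(* Fix $z\in\mathbb{C}$. As $\alpha\to0^+$, $$\int_{-\infty}^{\infty}\frac{e^{-\alpha x^2}\sinh(\sqrt{\alpha}\,xz)}{e^{2\pi x}-1}\, dx\sim\frac{-z}{\sqrt{\pi\alpha}}e^{z^2/4}\sum_{m=0}^{\infty}\left(\frac{-\alpha}{\pi^2}\right)^{m}\zeta(2m)\,\Gamma\left(m+\frac12\right){}_1F_1\left(m+\frac12;\frac32;\frac{-z^2}{4}\right).$$
   Context: $\zeta$ is the Riemann zeta function (so $\zeta(0)=-1/2$); ${}_1F_1(a;c;w)$ is Kummer's confluent hypergeometric function. The asymptotic expansion is meant in the Poincaré sense as $\alpha\to0^+$. *)

theory Defs
  imports "HOL-Complex_Analysis.Complex_Analysis" "HOL-Library.Landau_Symbols"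
begin

text \<open>
  The Riemann zeta function: the analytic continuation to the complex plane minus the point 1 of
  the sum of \<open>n powr (-s)\<close> over \<open>n \<ge> 1\<close>, which converges for \<open>Re s > 1\<close>.
  The value 0 at the pole is a convention that makes the continuation unique as a total function.
\<close>
definition riemann_zeta :: "complex \<Rightarrow> complex" where
  "riemann_zeta = (THE f. f holomorphic_on - {1} \<and> f 1 = 0 \<and>
     (\<forall>s. Re s > 1 \<longrightarrow> f s = (\<Sum>n. of_nat (Suc n) powr (- s))))"

text \<open>
  Kummer's function, the sum of \<open>pochhammer a n / pochhammer c n * w ^ n / fact n\<close>;
  meaningful when \<open>c\<close> is not a nonpositive integer.
\<close>
definition kummer_1F1 :: "complex \<Rightarrow> complex \<Rightarrow> complex \<Rightarrow> complex" where
  "kummer_1F1 a c w = eval_fps (fps_hypergeo [a] [c] 1) w"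

text \<open>
  The Poincare asymptotic expansion \<open>f x \<sim> g x * (\<Sum>m. c m * \<phi> m x)\<close> along the filter \<open>F\<close>, where
  \<open>\<phi>\<close> is an asymptotic scale; the formal series is not required to converge. If \<open>g\<close> has no zeros
  near the limit point, this is the usual expansion of \<open>f / g\<close>.
\<close>
definition poincare_expansion ::
  "'a filter \<Rightarrow> ('a \<Rightarrow> complex) \<Rightarrow> ('a \<Rightarrow> complex) \<Rightarrow>
   (nat \<Rightarrow> 'a \<Rightarrow> complex) \<Rightarrow> (nat \<Rightarrow> complex) \<Rightarrow> bool" where
  "poincare_expansion F f g \<phi> c \<longleftrightarrow>
     (\<forall>m. \<phi> (Suc m) \<in> o[F](\<phi> m)) \<and>
     (\<forall>N. (\<lambda>x. f x - g x * (\<Sum>m\<le>N. c m * \<phi> m x)) \<in> o[F](\<lambda>x. g x * \<phi> N x))"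

end

(* On the half line the reflection 1/(exp(-y) - 1) = -1 - 1/(exp y - 1) splits the integral of the
   odd function G(t) = exp(-t^2) sinh(t z), t = sqrt(alpha) x, into the plain integral of G, which
   is the term m = 0 because zeta(0) = -1/2, and twice a Bose integral. A Taylor polynomial of G at
   0 has a remainder of size C t^(2N+1) on the whole half line, so the Bose part is expanded by
   integrating termwise: x^(2k+1)/(exp(2 pi x) - 1) has integral
   (2k+1)! zeta(2k+2)/(2 pi)^(2k+2). Kummer's transformation turns the 1F1 of the term m = k + 1
   into a polynomial of degree k in z^2, which is the Taylor coefficient of t^(2k+1) in G.

   The zeta function is continued through H(s) = (s - 1)(zeta(s) - 1): expanding
   (n-1)^(1-s) - n^(1-s) binomially and summing over n >= 2 expresses H(s) by the values H(s + j),
   j >= 1, which extends H one unit to the left. The same recursion gives H(1) = 1 and H(0) = 3/2. *)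

theory Submission
  imports Defs "HOL-Probability.Distributions" "HOL-Real_Asymp.Real_Asymp"
begin

section \<open>Analytic continuation of zeta by a binomial recursion, and its value at 0\<close>

section \<open>Continuation of the zeta function\<close>

text \<open>These are the terms of the binomial series of (1 - 1/2)^(-r). It majorizes the series
  below, where bases n >= 2 supply a factor of at most 1/2 per step.\<close>

lemma summable_pochhammer_half:
  "summable (\<lambda>n. pochhammer (r::real) n / fact n * (1/2) ^ n)"
proof -
  have "summable (\<lambda>n. ((-r) gchoose n) * (-1/2) ^ n)"
    using gen_binomial_real[of "-1/2" "-r"] by (simp add: sums_iff)
  also have "(\<lambda>n. ((-r) gchoose n) * (-1/2) ^ n) = (\<lambda>n. pochhammer r n / fact n * (1/2) ^ n)"
    by (auto simp: gbinomial_pochhammer power_divide fun_eq_iff power_minus1_even)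
       (auto simp: field_simps simp flip: power_mult_distrib)
  finally show ?thesis .
qed

lemma norm_pochhammer_le:
  "norm (pochhammer (z::complex) n) \<le> pochhammer (norm z) n"
proof (induction n)
  case (Suc n)
  have "norm (z + of_nat n) \<le> norm z + of_nat n"
    by (rule order.trans[OF norm_triangle_ineq]) simp
  with Suc show ?case
    by (auto simp: pochhammer_Suc norm_mult pochhammer_prod intro!: mult_mono prod_nonneg)
qed simp

lemma pochhammer_nonneg_real: "0 \<le> x \<Longrightarrow> 0 \<le> pochhammer (x::real) n"
  by (auto simp: pochhammer_prod intro!: prod_nonneg)

lemma pochhammer_mono_real:
  assumes "0 \<le> x" "x \<le> (y::real)"
  shows "pochhammer x n \<le> pochhammer y n"
  using assms by (auto simp: pochhammer_prod intro!: prod_mono)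

section \<open>The Dirichlet series in the half plane Re s > 1\<close>

definition dirichlet_zeta :: "complex \<Rightarrow> complex" where
  "dirichlet_zeta s = (\<Sum>n. of_nat (Suc n) powr (- s))"

lemma norm_of_nat_powr: "n > 0 \<Longrightarrow> norm (of_nat n powr (s::complex)) = real n powr Re s"
  by (subst norm_powr_real_powr) auto

lemma summable_nat_powr: "\<sigma> > 1 \<Longrightarrow> summable (\<lambda>n. real (n + k) powr - \<sigma>)"
  using summable_iff_shift[of "\<lambda>n. real n powr - \<sigma>" k] by (simp add: summable_real_powr_iff)

lemma dirichlet_zeta_sums:
  assumes "Re s > 1"
  shows "(\<lambda>n. of_nat (Suc n) powr (- s)) sums dirichlet_zeta s"
proof -
  have "summable (\<lambda>n. norm (of_nat (Suc n) powr (- s) :: complex))"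
    using summable_nat_powr[OF assms, of 1] by (subst norm_of_nat_powr) auto
  thus ?thesis
    unfolding dirichlet_zeta_def by (rule summable_sums[OF summable_norm_cancel])
qed

lemma dirichlet_zeta_sums_tail:
  assumes "Re s > 1"
  shows "(\<lambda>n. of_nat (n + 2) powr (- s)) sums (dirichlet_zeta s - 1)"
  using sums_split_initial_segment[OF dirichlet_zeta_sums[OF assms], of 1] by simp

text \<open>The function H on Re s > 1. The factor \<open>s - 1\<close> cancels the pole at 1;
  without the term n = 1 all bases are at least 2, so the other factor decays like 2^(-Re
  s).\<close>

definition zeta_tail :: "complex \<Rightarrow> complex" where
  "zeta_tail s = (s - 1) * (dirichlet_zeta s - 1)"

text \<open>Split n^(-sigma) as n^(2 - sigma) n^(-2). For sigma >= 2 and n >= 2 the first factor is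
  at most 4 * 2^(-sigma), and the sum of n^(-2) goes into the constant.\<close>

lemma norm_dirichlet_zeta_minus_1_le:
  obtains C where "C \<ge> 0" "\<And>s. Re s \<ge> 2 \<Longrightarrow> norm (dirichlet_zeta s - 1) \<le> C * 2 powr (- Re s)"
proof -
  define C where "C = 4 * (\<Sum>n. real (n + 2) powr - 2)"
  show ?thesis
  proof
    show "C \<ge> 0"
      unfolding C_def by (intro mult_nonneg_nonneg suminf_nonneg summable_nat_powr) auto
    fix s :: complex assume s: "Re s \<ge> 2"
    have le: "norm (of_nat (n + 2) powr (- s) :: complex) \<le> 4 * 2 powr (- Re s) * real (n + 2) powr - 2" for n
    proof -
      have "norm (of_nat (n + 2) powr (- s) :: complex) = real (n + 2) powr (2 - Re s) * real (n + 2) powr - 2"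
        by (subst norm_of_nat_powr) (auto simp flip: powr_add)
      also have "real (n + 2) powr (2 - Re s) \<le> 2 powr (2 - Re s)"
        using s by (intro powr_mono2') auto
      also have "2 powr (2 - Re s) = 4 * 2 powr (- Re s)"
        using powr_add[of 2 2 "-Re s"] by simp
      finally show ?thesis by (simp add: mult_right_mono)
    qed
    have "norm (dirichlet_zeta s - 1) = norm (\<Sum>n. of_nat (n + 2) powr (- s) :: complex)"
      using dirichlet_zeta_sums_tail[of s] s by (simp add: sums_iff)
    also have "\<dots> \<le> (\<Sum>n. 4 * 2 powr (- Re s) * real (n + 2) powr - 2)"
      by (rule norm_suminf_le[OF le]) (intro summable_mult summable_nat_powr[of 2 2], simp)
    also have "\<dots> = C * 2 powr (- Re s)"
      unfolding C_def using suminf_mult[OF summable_nat_powr[of 2 2]] by simp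
    finally show "norm (dirichlet_zeta s - 1) \<le> C * 2 powr (- Re s)" .
  qed
qed

text \<open>Weierstrass's test with a local majorant. It is demanded for large \<open>n\<close>
  only, because in the continuation step the first terms have no usable bound.\<close>

lemma holomorphic_on_suminf_local:
  fixes f :: "nat \<Rightarrow> complex \<Rightarrow> complex"
  assumes "open S" "\<And>n. f n holomorphic_on S"
    and "\<And>x. x \<in> S \<Longrightarrow> \<exists>d h. 0 < d \<and> summable h \<and> (\<forall>\<^sub>F n in sequentially. \<forall>y\<in>ball x d \<inter> S. norm (f n y) \<le> h n)"
  shows "(\<lambda>s. \<Sum>n. f n s) holomorphic_on S"
proof -
  have "\<exists>g g'. \<forall>x\<in>S. ((\<lambda>n. f n x) sums g x) \<and> ((\<lambda>n. deriv (f n) x) sums g' x) \<and> (g has_field_derivative g' x) (at x)"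
    by (rule series_and_derivative_comparison_local) (use assms in \<open>auto intro: holomorphic_derivI\<close>)
  then obtain g g' where g: "\<And>x. x \<in> S \<Longrightarrow> (\<lambda>n. f n x) sums g x"
    "\<And>x. x \<in> S \<Longrightarrow> (g has_field_derivative g' x) (at x)" by blast
  have "g holomorphic_on S"
    using g(2) assms(1) by (auto simp: holomorphic_on_open)
  thus ?thesis
    by (rule holomorphic_transform) (use g(1) in \<open>auto simp: sums_iff\<close>)
qed

lemma holomorphic_dirichlet_zeta: "dirichlet_zeta holomorphic_on {s. Re s > 1}"
  unfolding dirichlet_zeta_def[abs_def]
proof (rule holomorphic_on_suminf_local)
  fix s assume "s \<in> {s. Re s > 1}"
  hence s: "Re s > 1" by simp
  \<comment> \<open>The midpoint of 1 and \<open>Re s\<close>: on the ball of radius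
    \<open>Re s - \<sigma>\<close> real parts stay above \<open>\<sigma>\<close>, which itself
    exceeds 1.\<close>
  define \<sigma> where "\<sigma> = (1 + Re s) / 2"
  have \<sigma>: "\<sigma> > 1" using s by (simp add: \<sigma>_def)
  have "norm (of_nat (Suc n) powr (- y) :: complex) \<le> real (n + 1) powr - \<sigma>"
    if "y \<in> ball s (Re s - \<sigma>)" for n y
  proof -
    have "Re s - Re y < Re s - \<sigma>"
      using that abs_Re_le_cmod[of "s - y"] by (auto simp: dist_norm)
    thus ?thesis by (subst norm_of_nat_powr) (auto intro!: powr_mono)
  qed
  thus "\<exists>d h. 0 < d \<and> summable h \<and> (\<forall>\<^sub>F n in sequentially. \<forall>y\<in>ball s d \<inter> {s. Re s > 1}. norm (of_nat (Suc n) powr (- y) :: complex) \<le> h n)"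
    using summable_nat_powr[OF \<sigma>, of 1] s
    by (intro exI[of _ "Re s - \<sigma>"] exI[of _ "\<lambda>n. real (n + 1) powr - \<sigma>"])
       (auto simp: \<sigma>_def)
qed (auto intro!: holomorphic_intros open_halfspace_Re_gt)

text \<open>Expand (n+1)^(1-s) = ((n+2) - 1)^(1-s) binomially and subtract (n+2)^(1-s). Summing rows
  first telescopes to 1; summing columns first gives the values zeta(s + k) - 1. Absolute
  summability of the double family allows the exchange.\<close>

lemma zeta_tail_binomial:
  assumes s: "Re s > 1"
  shows "(\<lambda>k. pochhammer (s - 1) (Suc k) / fact (Suc k) * (dirichlet_zeta (s + of_nat k) - 1)) sums 1"
proof -
  define r where "r = norm (s - 1)"
  define a where "a = (\<lambda>n k. pochhammer (s - 1) (Suc k) / fact (Suc k) * of_nat (n + 2) powr (- (s + of_nat k)))"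
  have row: "(\<lambda>k. a n k) sums (of_nat (n + 1) powr (1 - s) - of_nat (n + 2) powr (1 - s))" for n
  proof -
    have "(\<lambda>k. (1 - s gchoose k) * of_real (real (n + 2)) powr (1 - s - of_nat k) * of_real (-1) ^ k) sums
          of_real (real (n + 2) + -1) powr (1 - s)"
      by (rule gen_binomial_complex'') auto
    \<comment> \<open>The term k = 0 of the binomial series is (n+2)^(1-s); removing it shifts the
      exponents to -s - k.\<close>
    from sums_split_initial_segment[OF this, of 1]
    have *: "(\<lambda>k. (1 - s gchoose Suc k) * of_nat (n + 2) powr (- s - of_nat k) * (-1) ^ Suc k) sums
          (of_nat (n + 1) powr (1 - s) - of_nat (n + 2) powr (1 - s))"
      by (simp add: add.commute)
    have eq: "(1 - s gchoose Suc k) * of_nat (n + 2) powr (- s - of_nat k) * (-1) ^ Suc k = a n k" for k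
    proof -
      have 1: "(1 - s gchoose Suc k) = (-1) ^ Suc k * (pochhammer (s - 1) (Suc k) / fact (Suc k))"
        by (simp only: gbinomial_pochhammer minus_diff_eq times_divide_eq_right)
      have 2: "- s - of_nat k = - (s + of_nat k)" by simp
      have 3: "(-1) ^ Suc k * x * y * (-1) ^ Suc k = x * y" for x y :: complex
        by (cases "even k") auto
      show ?thesis unfolding a_def 1 2 by (rule 3)
    qed
    show ?thesis using * unfolding eq .
  qed
  have col: "(\<lambda>n. a n k) sums (pochhammer (s - 1) (Suc k) / fact (Suc k) * (dirichlet_zeta (s + of_nat k) - 1))" for k
    unfolding a_def by (intro sums_mult dirichlet_zeta_sums_tail) (use s in auto)
  \<comment> \<open>The majorant is a product of a function of \<open>n\<close> and one of
    \<open>k\<close>, so the double family is summable as soon as both factors are. The factor 2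
    compensates for writing (1/2)^k with exponent \<open>Suc k\<close>.\<close>
  have bound: "norm (a n k) \<le> real (n + 2) powr (- Re s) * (2 * (pochhammer r (Suc k) / fact (Suc k) * (1/2) ^ Suc k))" for n k
  proof -
    have 1: "norm (of_nat (n + 2) powr (- (s + of_nat k)) :: complex) = real (n + 2) powr (- Re s) * real (n + 2) powr - real k"
      by (subst norm_of_nat_powr) (auto simp flip: powr_add)
    have "real (n + 2) powr - real k \<le> 2 powr - real k"
      by (intro powr_mono2') auto
    also have "\<dots> = (1/2) ^ k" by (simp add: powr_minus powr_realpow power_divide inverse_eq_divide)
    finally have 2: "real (n + 2) powr - real k \<le> (1/2) ^ k" .
    have "norm (a n k) = norm (pochhammer (s - 1) (Suc k)) / fact (Suc k) * (real (n + 2) powr (- Re s) * real (n + 2) powr - real k)"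
      unfolding a_def norm_mult[of "_ / _"] norm_divide 1 norm_fact ..
    also have "\<dots> \<le> pochhammer r (Suc k) / fact (Suc k) * (real (n + 2) powr (- Re s) * (1/2)^k)"
      unfolding r_def by (intro mult_mono divide_right_mono norm_pochhammer_le 2)
        (auto intro!: mult_nonneg_nonneg divide_nonneg_nonneg simp: pochhammer_prod prod_nonneg)
    also have "\<dots> = real (n + 2) powr (- Re s) * (2 * (pochhammer r (Suc k) / fact (Suc k) * (1/2) ^ Suc k))"
      by simp
    finally show ?thesis .
  qed
  have s1: "(\<lambda>n. real (n + 2) powr (- Re s)) summable_on UNIV"
    using summable_nat_powr[OF s, of 2] by (intro summable_nonneg_imp_summable_on) simp_all
  have "summable (\<lambda>k. pochhammer r (Suc k) / fact (Suc k) * (1/2) ^ Suc k)"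
    using summable_pochhammer_half[of r]
    by (subst (asm) summable_Suc_iff [where f = "\<lambda>k. pochhammer r k / fact k * (1/2) ^ k", symmetric])
  moreover have r_nonneg: "0 \<le> pochhammer r (Suc k) / fact (Suc k) * (1/2) ^ Suc k" for k
    unfolding r_def by (intro mult_nonneg_nonneg divide_nonneg_nonneg) (auto simp: pochhammer_prod prod_nonneg)
  ultimately have s2: "(\<lambda>k. 2 * (pochhammer r (Suc k) / fact (Suc k) * (1/2) ^ Suc k)) summable_on UNIV"
    by (intro summable_on_cmult_right summable_nonneg_imp_summable_on)
  have "(\<lambda>(n,k). real (n + 2) powr (- Re s) * (2 * (pochhammer r (Suc k) / fact (Suc k) * (1/2) ^ Suc k))) summable_on UNIV \<times> UNIV"
  proof (rule summable_on_SigmaI)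
    show "((\<lambda>k. case (n, k) of (n, k) \<Rightarrow> real (n + 2) powr (- Re s) * (2 * (pochhammer r (Suc k) / fact (Suc k) * (1/2) ^ Suc k)))
       has_sum (real (n + 2) powr (- Re s) * infsum (\<lambda>k. 2 * (pochhammer r (Suc k) / fact (Suc k) * (1/2) ^ Suc k)) UNIV)) UNIV" for n
      unfolding prod.case by (intro has_sum_cmult_right has_sum_infsum s2)
  next
    show "(\<lambda>n. real (n + 2) powr (- Re s) * infsum (\<lambda>k. 2 * (pochhammer r (Suc k) / fact (Suc k) * (1/2) ^ Suc k)) UNIV) summable_on UNIV"
      by (intro summable_on_cmult_left s1)
  qed (use bound[THEN order.trans[OF norm_ge_zero]] in auto)
  hence "(\<lambda>x. norm ((\<lambda>(n,k). a n k) x)) summable_on UNIV \<times> UNIV"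
    by (rule summable_on_comparison_test) (use bound in auto)
  hence sm: "(\<lambda>(n,k). a n k) summable_on UNIV \<times> UNIV"
    by (rule abs_summable_summable)
  \<comment> \<open>Exchanging the order needs unordered sums. They exist by the double summability,
    and their values are those of the ordered sums \<open>row\<close> and
    \<open>col\<close>.\<close>
  have hrow: "((\<lambda>k. a n k) has_sum (of_nat (n + 1) powr (1 - s) - of_nat (n + 2) powr (1 - s))) UNIV" for n
  proof -
    from summable_on_SigmaD1[OF sm, of n] have *: "(\<lambda>k. a n k) summable_on UNIV" by simp
    show ?thesis
      using has_sum_infsum[OF *] sums_unique2[OF has_sum_imp_sums[OF has_sum_infsum[OF *]] row[of n]] by simp
  qed
  have hcol: "((\<lambda>n. a n k) has_sum (pochhammer (s - 1) (Suc k) / fact (Suc k) * (dirichlet_zeta (s + of_nat k) - 1))) UNIV" for k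
  proof -
    have "(\<lambda>(k,n). a n k) summable_on UNIV \<times> UNIV"
      using sm by (subst summable_on_swap) (simp add: case_prod_unfold)
    from summable_on_SigmaD1[OF this, of k] have *: "(\<lambda>n. a n k) summable_on UNIV" by simp
    show ?thesis
      using has_sum_infsum[OF *] sums_unique2[OF has_sum_imp_sums[OF has_sum_infsum[OF *]] col[of k]] by simp
  qed
  define T where "T = infsum (\<lambda>(n,k). a n k) (UNIV \<times> UNIV)"
  have T: "((\<lambda>(n,k). a n k) has_sum T) (UNIV \<times> UNIV)"
    unfolding T_def using sm by (rule has_sum_infsum)
  have "((\<lambda>n. of_nat (n + 1) powr (1 - s) - of_nat (n + 2) powr (1 - s)) has_sum T) UNIV"
    by (rule has_sum_SigmaD[OF T]) (use hrow in auto)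
  hence T1: "(\<lambda>n. of_nat (n + 1) powr (1 - s) - of_nat (n + 2) powr (1 - s)) sums T"
    by (rule has_sum_imp_sums)
  \<comment> \<open>With this limit the telescoping sum equals its first term 1^(1-s) = 1.\<close>
  have lim: "(\<lambda>n. of_nat (n + 1) powr (1 - s)) \<longlonglongrightarrow> 0"
  proof (rule tendsto_norm_zero_cancel)
    have "(\<lambda>n. real (n + 1) powr (1 - Re s)) \<longlonglongrightarrow> 0"
      using s by real_asymp
    moreover have "norm (of_nat (n + 1) powr (1 - s) :: complex) = real (n + 1) powr (1 - Re s)" for n
      by (subst norm_of_nat_powr) auto
    ultimately show "(\<lambda>n. norm (of_nat (n + 1) powr (1 - s) :: complex)) \<longlonglongrightarrow> 0" by (simp only:)
  qed
  have "(\<lambda>n. of_nat (n + 1) powr (1 - s) - of_nat (n + 2) powr (1 - s)) sums 1"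
    using telescope_sums'[OF lim] by simp
  with T1 have "T = 1" by (rule sums_unique2)
  have "((\<lambda>(k,n). a n k) has_sum T) (UNIV \<times> UNIV)"
    using T[THEN has_sum_swap[THEN iffD1]] by simp
  hence "((\<lambda>k. pochhammer (s - 1) (Suc k) / fact (Suc k) * (dirichlet_zeta (s + of_nat k) - 1)) has_sum T) UNIV"
    by (rule has_sum_SigmaD) (use hcol in simp_all)
  thus ?thesis unfolding \<open>T = 1\<close> by (rule has_sum_imp_sums)
qed

text \<open>The term k = 0 of the binomial identity is \<open>zeta_tail s\<close> itself. For k = i
  + 1 the last factor of the Pochhammer symbol is (s + i + 1) - 1, exactly what turns zeta(s + i +
  1) - 1 into a value of \<open>zeta_tail\<close>.\<close>

lemma zeta_tail_recurrence:
  assumes s: "Re s > 1"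
  shows "(\<lambda>i. pochhammer (s - 1) (Suc i) / fact (i + 2) * zeta_tail (s + of_nat (Suc i))) sums (1 - zeta_tail s)"
proof -
  have *: "pochhammer (s - 1) (Suc (i + 1)) / fact (Suc (i + 1)) * (dirichlet_zeta (s + of_nat (i + 1)) - 1) =
        pochhammer (s - 1) (Suc i) / fact (i + 2) * zeta_tail (s + of_nat (Suc i))" for i
  proof -
    have "s + of_nat (Suc i) - 1 = s - 1 + of_nat (Suc i)" by simp
    thus ?thesis unfolding zeta_tail_def
      by (simp only: Suc_eq_plus1[symmetric] pochhammer_Suc[of _ "Suc i"] add_2_eq_Suc' times_divide_eq_left mult.assoc)
  qed
  show ?thesis
    using sums_split_initial_segment[OF zeta_tail_binomial[OF s], of 1] unfolding *
    by (simp add: zeta_tail_def)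
qed

text \<open>The recursion solved for its value at \<open>s\<close>. Only arguments at least one unit
  to the right of \<open>s\<close> occur, so each application enlarges the half plane by one
  unit.\<close>

definition zeta_step :: "(complex \<Rightarrow> complex) \<Rightarrow> complex \<Rightarrow> complex" where
  "zeta_step H s = 1 - (\<Sum>i. pochhammer (s - 1) (Suc i) / fact (i + 2) * H (s + of_nat (Suc i)))"

lemma zeta_step_eq:
  assumes "\<And>s. Re s > 1 \<Longrightarrow> H s = zeta_tail s" "Re s > 1"
  shows "zeta_step H s = zeta_tail s"
proof -
  have "H (s + of_nat (Suc i)) = zeta_tail (s + of_nat (Suc i))" for i
    using assms(2) by (intro assms(1)) auto
  thus ?thesis
    unfolding zeta_step_def by (simp only: sums_unique[OF zeta_tail_recurrence[OF assms(2)], symmetric]) simp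
qed

text \<open>Each summand is holomorphic on the larger half plane. For large \<open>i\<close> the
  shifted argument lies in Re >= 2, where \<open>H\<close> is \<open>zeta_tail\<close> and its
  exponential decay beats the Pochhammer quotient.\<close>

lemma holomorphic_zeta_step:
  assumes hol: "H holomorphic_on {s. Re s > a}" and eq: "\<And>s. Re s > 1 \<Longrightarrow> H s = zeta_tail s"
  shows "zeta_step H holomorphic_on {s. Re s > a - 1}"
proof -
  obtain C where C: "C \<ge> 0" "\<And>s. Re s \<ge> 2 \<Longrightarrow> norm (dirichlet_zeta s - 1) \<le> C * 2 powr (- Re s)"
    using norm_dirichlet_zeta_minus_1_le by blast
  have "(\<lambda>s. \<Sum>i. pochhammer (s - 1) (Suc i) / fact (i + 2) * H (s + of_nat (Suc i))) holomorphic_on {s. Re s > a - 1}"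
  proof (rule holomorphic_on_suminf_local)
    show "(\<lambda>s. pochhammer (s - 1) (Suc i) / fact (i + 2) * H (s + of_nat (Suc i))) holomorphic_on {s. Re s > a - 1}" for i
    proof -
      have "(\<lambda>s. H (s + of_nat (Suc i))) holomorphic_on {s. Re s > a - 1}"
        by (rule holomorphic_on_compose_gen[OF _ hol, unfolded o_def]) (auto intro!: holomorphic_intros)
      thus ?thesis unfolding pochhammer_prod by (auto intro!: holomorphic_intros)
    qed
  next
    fix s0 :: complex assume "s0 \<in> {s. Re s > a - 1}"
    \<comment> \<open>On the unit ball around \<open>s0\<close> this bounds both |s - 1| and - Re
      s.\<close>
    define R where "R = norm s0 + 2"
    have R: "R \<ge> 2" by (simp add: R_def)
    \<comment> \<open>The bound on \<open>H\<close> contributes R + i + 1, the last factor of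
      \<open>pochhammer R (i + 2)\<close>, and 2^(R - i - 1) = 2^R * 2 * (1/2)^(i + 2). So
      \<open>h\<close> is a multiple of a shifted binomial series.\<close>
    define h where "h = (\<lambda>i. C * 2 powr R * 2 * (pochhammer R (i + 2) / fact (i + 2) * (1/2) ^ (i + 2)))"
    have "summable h" unfolding h_def
      using summable_ignore_initial_segment[OF summable_pochhammer_half[of R], of 2]
      by (intro summable_mult) simp
    moreover have "\<forall>\<^sub>F i in sequentially. \<forall>s\<in>ball s0 1 \<inter> {s. Re s > a - 1}.
        norm (pochhammer (s - 1) (Suc i) / fact (i + 2) * H (s + of_nat (Suc i))) \<le> h i"
      \<comment> \<open>From this index on, Re (s + i + 1) >= -R + (R + 1) + 1 = 2.\<close>
      using eventually_ge_at_top[of "nat \<lceil>R + 1\<rceil>"]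
    proof (eventually_elim, safe)
      fix i s assume i: "i \<ge> nat \<lceil>R + 1\<rceil>" and s: "s \<in> ball s0 1"
      have i': "real i \<ge> R + 1" using i by linarith
      have "norm s \<le> norm s0 + 1"
        using s norm_triangle_ineq2[of s s0] by (auto simp: dist_norm norm_minus_commute)
      hence s1: "norm (s - 1) \<le> R" and s2: "- Re s \<le> R"
        using norm_triangle_ineq4[of s 1] abs_Re_le_cmod[of s] by (auto simp: R_def)
      let ?t = "s + of_nat (Suc i)"
      have t: "Re ?t \<ge> 2" using s2 i' by simp
      have "H ?t = (s - 1 + of_nat (Suc i)) * (dirichlet_zeta ?t - 1)"
        using t by (subst eq) (auto simp: zeta_tail_def algebra_simps)
      hence "norm (H ?t) = norm (s - 1 + of_nat (Suc i)) * norm (dirichlet_zeta ?t - 1)"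
        by (simp only: norm_mult)
      also have "\<dots> \<le> (R + real (Suc i)) * (C * (2 powr R * 2 * (1/2) ^ (i + 2)))"
      proof (rule mult_mono)
        show "norm (s - 1 + of_nat (Suc i)) \<le> R + real (Suc i)"
          using norm_triangle_ineq[of "s - 1" "of_nat (Suc i)"] s1 by (simp del: of_nat_Suc)
        have "norm (dirichlet_zeta ?t - 1) \<le> C * 2 powr (- Re ?t)"
          using t by (rule C(2))
        also have "\<dots> \<le> C * 2 powr (R - real (Suc i))"
          using C(1) s2 by (intro mult_left_mono powr_mono) auto
        also have "2 powr (R - real (Suc i)) = 2 powr R * 2 * (1/2) ^ (i + 2)"
          by (simp add: powr_diff powr_add powr_realpow power_divide field_simps)
        finally show "norm (dirichlet_zeta ?t - 1) \<le> C * (2 powr R * 2 * (1/2) ^ (i + 2))" .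
      qed (use R C(1) in auto)
      finally have Hb: "norm (H ?t) \<le> (R + real (Suc i)) * (C * (2 powr R * 2 * (1/2) ^ (i + 2)))" .
      have "norm (pochhammer (s - 1) (Suc i)) \<le> pochhammer R (Suc i)"
        using norm_pochhammer_le[of "s - 1" "Suc i"] pochhammer_mono_real[OF _ s1, of "Suc i"] by simp
      hence "norm (pochhammer (s - 1) (Suc i) / fact (i + 2) * H ?t) \<le>
          pochhammer R (Suc i) / fact (i + 2) * ((R + real (Suc i)) * (C * (2 powr R * 2 * (1/2) ^ (i + 2))))"
        unfolding norm_mult norm_divide norm_fact using R
        by (intro mult_mono divide_right_mono Hb) (auto intro!: divide_nonneg_nonneg mult_nonneg_nonneg pochhammer_nonneg_real simp del: of_nat_Suc)
      also have "\<dots> = h i"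
        unfolding h_def by (simp only: add_2_eq_Suc' pochhammer_Suc[of _ "Suc i"]) (simp only: mult_ac times_divide_eq_right times_divide_eq_left)
      finally show "norm (pochhammer (s - 1) (Suc i) / fact (i + 2) * H ?t) \<le> h i" .
    qed
    ultimately show "\<exists>d h. 0 < d \<and> summable h \<and> (\<forall>\<^sub>F i in sequentially. \<forall>s\<in>ball s0 d \<inter> {s. Re s > a - 1}.
        norm (pochhammer (s - 1) (Suc i) / fact (i + 2) * H (s + of_nat (Suc i))) \<le> h i)"
      by (intro exI[of _ 1] exI[of _ h]) auto
  qed (rule open_halfspace_Re_gt)
  thus ?thesis
    unfolding zeta_step_def[abs_def] by (intro holomorphic_intros)
qed

lemma zeta_tail_halfplane:
  "\<exists>H. H holomorphic_on {s. Re s > 1 - real k} \<and> (\<forall>s. Re s > 1 \<longrightarrow> H s = zeta_tail s)"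
proof (induction k)
  case 0
  show ?case
    by (intro exI[of _ zeta_tail])
       (auto simp: zeta_tail_def[abs_def] intro!: holomorphic_intros holomorphic_dirichlet_zeta)
next
  case (Suc k)
  then obtain H where "H holomorphic_on {s. Re s > 1 - real k}" "\<And>s. Re s > 1 \<Longrightarrow> H s = zeta_tail s"
    by blast
  with holomorphic_zeta_step[of H "1 - real k"] zeta_step_eq[of H] show ?case
    by (intro exI[of _ "zeta_step H"]) (auto simp: algebra_simps)
qed

section \<open>Gluing the extensions to an entire function, and identification of zeta\<close>

lemma halfplane_nonempty: "{s. Re s > 1} \<noteq> {}"
proof -
  have "(2::complex) \<in> {s. Re s > 1}" by simp
  thus ?thesis by blast
qed

text \<open>Extensions to different half planes agree on the smaller one by the identity theorem,
  since both equal \<open>zeta_tail\<close> on Re s > 1. Hence they glue along the exhausting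
  sequence of half planes.\<close>

lemma zeta_tail_entire:
  "\<exists>H. H holomorphic_on UNIV \<and> (\<forall>s. Re s > 1 \<longrightarrow> H s = zeta_tail s)"
proof -
  have "\<forall>k. \<exists>H. H holomorphic_on {s. Re s > 1 - real k} \<and> (\<forall>s. Re s > 1 \<longrightarrow> H s = zeta_tail s)"
    using zeta_tail_halfplane by (intro allI)
  then obtain h where
    h0: "\<forall>k. h k holomorphic_on {s. Re s > 1 - real k} \<and> (\<forall>s. Re s > 1 \<longrightarrow> h k s = zeta_tail s)"
    unfolding choice_iff by (elim exE)
  have h1: "h k holomorphic_on {s. Re s > 1 - real k}" for k using h0 by simp
  have h2: "Re s > 1 \<Longrightarrow> h k s = zeta_tail s" for k s
    using h0 by simp
  have agree: "h k s = h l s" if "k \<le> l" "Re s > 1 - real k" for k l s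
    proof (rule analytic_continuation_open[where s = "{s. Re s > 1}" and s' = "{s. Re s > 1 - real k}" and f = "h k" and g = "h l"])
    show "h l holomorphic_on {s. Re s > 1 - real k}"
      by (rule holomorphic_on_subset[OF h1]) (use that in auto)
    show "connected {s. Re s > 1 - real k}"
      by (intro convex_connected convex_halfspace_Re_gt)
    show "h k z = h l z" if "z \<in> {s. Re s > 1}" for z
      using that h2 by simp
    show "h k holomorphic_on {s. Re s > 1 - real k}" by (rule h1)
  qed (use that halfplane_nonempty in \<open>simp_all add: open_halfspace_Re_gt subset_iff\<close>)
  \<comment> \<open>Any k >= 2 - Re s satisfies 1 - k <= Re s - 1 < Re s, so the chosen extension is
    holomorphic at \<open>s\<close>.\<close>
  define H where "H s = h (nat \<lceil>2 - Re s\<rceil>) s" for s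
  have H: "H s = h k s" if "Re s > 1 - real k" for k s
  proof -
    have "Re s > 1 - real (nat \<lceil>2 - Re s\<rceil>)" by linarith
    with that agree[of k "nat \<lceil>2 - Re s\<rceil>" s] agree[of "nat \<lceil>2 - Re s\<rceil>" k s] show ?thesis
      unfolding H_def by (cases "k \<le> nat \<lceil>2 - Re s\<rceil>") simp_all
  qed
  show ?thesis
  proof (intro exI[of _ H] conjI allI impI)
    have "H holomorphic_on (\<Union>k. {s. Re s > 1 - real k})"
    proof (rule holomorphic_on_UN_open)
      show "H holomorphic_on {s. Re s > 1 - real k}" for k
        by (rule holomorphic_transform[OF h1]) (use H in simp)
    qed (rule open_halfspace_Re_gt)
    also have "(\<Union>k. {s. Re s > 1 - real k}) = UNIV"
    proof -
      have "\<exists>k. Re s > 1 - real k" for s :: complex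
        using reals_Archimedean2[of "1 - Re s"] by (auto simp: algebra_simps)
      thus ?thesis by blast
    qed
    finally show "H holomorphic_on UNIV" .
    show "H s = zeta_tail s" if "Re s > 1" for s
      using H[of 0 s] h2[of s 0] that by simp
  qed
qed

text \<open>The plane without 1 is connected, so the identity theorem fixes the function off 1, and
  the convention at 1 fixes the rest; this discharges the \<open>THE\<close> in the
  definition.\<close>

lemma riemann_zeta_unique:
  assumes "f holomorphic_on - {1}" "f 1 = 0" "\<And>s. Re s > 1 \<Longrightarrow> f s = dirichlet_zeta s"
  shows "riemann_zeta = f"
  unfolding riemann_zeta_def
proof (rule the_equality)
  show "f holomorphic_on - {1} \<and> f 1 = 0 \<and> (\<forall>s. Re s > 1 \<longrightarrow> f s = (\<Sum>n. of_nat (Suc n) powr (- s)))"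
    using assms by (auto simp: dirichlet_zeta_def)
  fix g assume g: "g holomorphic_on - {1} \<and> g 1 = 0 \<and> (\<forall>s. Re s > 1 \<longrightarrow> g s = (\<Sum>n. of_nat (Suc n) powr (- s)))"
  have "g s = f s" if "s \<noteq> 1" for s
  proof (rule analytic_continuation_open[where s = "{s. Re s > 1}" and s' = "- {1}" and f = g and g = f])
    show "{s. Re s > 1} \<noteq> {}" by (rule halfplane_nonempty)
    show "connected (- {1 :: complex})" by (rule connected_punctured_universe) simp
  qed (use that g assms in \<open>auto simp: open_halfspace_Re_gt dirichlet_zeta_def\<close>)
  thus "g = f" using g assms(2) by (metis ext)
qed

text \<open>With the entire extension H, zeta(s) = 1 + H(s) / (s - 1), so zeta(0) = 1 - H(0).
  Existence of this function also makes the definite description meaningful.\<close>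

lemma riemann_zeta_eq_dirichlet:
  shows "Re s > 1 \<Longrightarrow> riemann_zeta s = dirichlet_zeta s"
  and riemann_zeta_0: "riemann_zeta 0 = - 1 / 2"
proof -
  obtain H where H: "H holomorphic_on UNIV" "\<And>s. Re s > 1 \<Longrightarrow> H s = zeta_tail s"
    using zeta_tail_entire by auto
  define f where "f s = (if s = 1 then 0 else 1 + H s / (s - 1))" for s
  have f: "f s = dirichlet_zeta s" if "Re s > 1" for s
    using that by (auto simp: f_def H zeta_tail_def)
  have "(\<lambda>s. 1 + H s / (s - 1)) holomorphic_on - {1}"
    by (auto intro!: holomorphic_intros holomorphic_on_subset[OF H(1)])
  hence hol: "f holomorphic_on - {1}"
    by (rule holomorphic_transform) (auto simp: f_def)
  have zeta: "riemann_zeta = f"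
    by (rule riemann_zeta_unique) (use hol f in \<open>auto simp: f_def\<close>)
  show "riemann_zeta s = dirichlet_zeta s" if "Re s > 1"
    using f that by (simp add: zeta)
  \<comment> \<open>Both sides are entire and agree on Re s > 1, so the recursion holds everywhere,
    in particular at 1 and 0.\<close>
  have step: "zeta_step H s = H s" for s
  proof (rule analytic_continuation_open[where s = "{s. Re s > 1}" and s' = UNIV and f = "zeta_step H" and g = H])
    show "{s. Re s > 1} \<noteq> {}" by (rule halfplane_nonempty)
    have "zeta_step H holomorphic_on (\<Union>a. {s. Re s > a - 1})"
    proof (rule holomorphic_on_UN_open)
      show "zeta_step H holomorphic_on {s. Re s > a - 1}" for a
        by (rule holomorphic_zeta_step) (use H in \<open>auto intro: holomorphic_on_subset\<close>)
    qed (rule open_halfspace_Re_gt)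
    also have "(\<Union>a. {s. Re s > a - 1}) = UNIV"
    proof -
      have "s \<in> {s'. Re s' > Re s - 1}" for s :: complex by simp
      thus ?thesis by blast
    qed
    finally show "zeta_step H holomorphic_on UNIV" .
  qed (use H zeta_step_eq[of H] in \<open>auto simp: open_halfspace_Re_gt\<close>)
  have "H 1 = 1"
  proof -
    have "pochhammer (1 - 1 :: complex) (Suc i) = 0" for i by (subst pochhammer_rec) simp
    thus ?thesis unfolding step[of 1, symmetric] zeta_step_def by simp
  qed
  \<comment> \<open>At s = 0 the Pochhammer symbols start at -1 and contain the factor 0 from i = 1
    on. The term i = 0 is -H(1)/2, whence H(0) = 1 + 1/2.\<close>
  have H0: "H 0 = 3 / 2"
  proof -
    have "(\<Sum>i. pochhammer (0 - 1 :: complex) (Suc i) / fact (i + 2) * H (0 + of_nat (Suc i))) =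
          (\<Sum>i\<in>{0}. pochhammer (0 - 1 :: complex) (Suc i) / fact (i + 2) * H (0 + of_nat (Suc i)))"
    proof (rule suminf_finite)
      fix i :: nat assume "i \<notin> {0}"
      hence "pochhammer (0 - 1 :: complex) (Suc i) = 0"
        using pochhammer_of_nat_eq_0_lemma[of 1 "Suc i"] by simp
      thus "pochhammer (0 - 1 :: complex) (Suc i) / fact (i + 2) * H (0 + of_nat (Suc i)) = 0" by simp
    qed auto
    thus ?thesis unfolding step[of 0, symmetric] zeta_step_def using \<open>H 1 = 1\<close>
      by (simp add: numeral_2_eq_2)
  qed
  show "riemann_zeta 0 = - 1 / 2"
    unfolding zeta f_def H0 by simp
qed

section \<open>Kummer's transformation and the coefficients of the expansion\<close>

section \<open>Kummer's function\<close>

text \<open>Ratio test: \<open>Re c > 0\<close> gives |c + n| >= n, so the quotients (a + n) / (c +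
  n) stay bounded.\<close>

lemma kummer_1F1_terms:
  assumes c: "Re c > 0"
  shows summable_norm_kummer_1F1:
      "summable (\<lambda>n. norm (pochhammer a n / pochhammer c n * w ^ n / fact n))" (is "summable (\<lambda>n. norm (?f n))")
    and kummer_1F1_sums:
      "(\<lambda>n. pochhammer a n / pochhammer c n * w ^ n / fact n) sums kummer_1F1 a c w"
proof -
  \<comment> \<open>For n >= N the ratio is at most (|a| + 1) |w| / (n + 1) <= 1/2; the summand 1
    ensures n >= 1, used in |a| + n <= (|a| + 1) n.\<close>
  define N where "N = nat \<lceil>2 * (norm a + 1) * norm w\<rceil> + 1"
  show sm: "summable (\<lambda>n. norm (?f n))"
  proof (rule summable_ratio_test)
    fix n assume n: "n \<ge> N"
    have n1: "real n \<ge> 1" using n by (simp add: N_def)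
    have n2: "2 * (norm a + 1) * norm w \<le> real n" using n unfolding N_def by linarith
    have "real n \<le> \<bar>Re (c + of_nat n)\<bar>" using c by simp
    also have "\<dots> \<le> norm (c + of_nat n)" by (rule abs_Re_le_cmod)
    finally have cn: "real n \<le> norm (c + of_nat n)" .
    have "norm (a + of_nat n) \<le> norm a + real n"
      by (rule order.trans[OF norm_triangle_ineq]) simp
    also have "\<dots> \<le> (norm a + 1) * real n"
      using n1 mult_left_mono[of 1 "real n" "norm a"] by (simp add: algebra_simps)
    finally have an: "norm (a + of_nat n) \<le> (norm a + 1) * real n" .
    have "norm (a + of_nat n) / norm (c + of_nat n) * norm w / real (Suc n) \<le>
          ((norm a + 1) * real n) / real n * norm w / real (Suc n)"
      by (intro divide_right_mono mult_right_mono frac_le an cn) (use n1 in auto)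
    also have "\<dots> = (norm a + 1) * norm w / real (Suc n)" using n1 by simp
    also have "\<dots> \<le> 1 / 2" using n2 by (simp add: field_simps)
    finally have le: "norm (a + of_nat n) / norm (c + of_nat n) * norm w / real (Suc n) \<le> 1 / 2" .
    have "norm (?f (Suc n)) = norm (a + of_nat n) / norm (c + of_nat n) * norm w / real (Suc n) * norm (?f n)"
      by (simp add: pochhammer_Suc norm_mult norm_divide norm_power fact_Suc mult_ac del: of_nat_Suc)
    also have "\<dots> \<le> 1 / 2 * norm (?f n)" by (intro mult_right_mono le) auto
    finally show "norm (norm (?f (Suc n))) \<le> 1 / 2 * norm (norm (?f n))" by simp
  qed simp
  have "fps_hypergeo [a] [c] 1 $ n * w ^ n = ?f n" for n by simp
  thus "?f sums kummer_1F1 a c w"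
    using summable_sums[OF summable_norm_cancel[OF sm]] by (simp add: kummer_1F1_def eval_fps_def)
qed

text \<open>Chu-Vandermonde: as (-1)^i (n choose i) = (-n)_i / i!, the sum is the terminating
  2F1(-n, a; c; 1).\<close>

lemma sum_binomial_pochhammer_quotient:
  fixes a c :: complex
  assumes "Re c > 0"
  shows "(\<Sum>i\<le>n. (-1) ^ i * of_nat (n choose i) * (pochhammer a i / pochhammer c i)) =
         pochhammer (c - a) n / pochhammer c n"
proof -
  have "(-1) ^ i * of_nat (n choose i) * (pochhammer a i / pochhammer c i) =
        pochhammer a i * pochhammer (- of_nat n) i / (of_nat (fact i) * pochhammer c i)" for i
    by (cases "even i") (simp_all add: binomial_gbinomial gbinomial_pochhammer)
  moreover have "c \<noteq> - of_nat i" for i using assms by (auto simp: complex_eq_iff)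
  ultimately show ?thesis
    using Vandermonde_pochhammer[of n c a] by (simp add: atLeast0AtMost)
qed

text \<open>Multiply the two series by the Cauchy product; Chu-Vandermonde evaluates each
  coefficient.\<close>

lemma kummer_transformation:
  assumes c: "Re c > 0"
  shows "exp w * kummer_1F1 a c (- w) = kummer_1F1 (c - a) c w"
proof -
  define f where "f n = pochhammer a n / pochhammer c n * (- w) ^ n / fact n" for n
  define g where "g n = w ^ n /\<^sub>R fact n" for n
  have f: "f sums kummer_1F1 a c (- w)" "summable (\<lambda>n. norm (f n))"
    unfolding f_def by (intro kummer_1F1_sums summable_norm_kummer_1F1 c)+
  have g: "g sums exp w" "summable (\<lambda>n. norm (g n))"
    unfolding g_def by (intro exp_converges summable_norm_exp)+
  have eq: "(\<Sum>i\<le>n. f i * g (n - i)) = pochhammer (c - a) n / pochhammer c n * w ^ n / fact n" for n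
  proof -
    have "f i * g (n - i) =
          w ^ n / fact n * ((-1) ^ i * of_nat (n choose i) * (pochhammer a i / pochhammer c i))" if "i \<le> n" for i
    proof -
      have 1: "w ^ n = w ^ i * w ^ (n - i)" using that by (simp flip: power_add)
      have 2: "of_nat (n choose i) = (fact n / (fact i * fact (n - i)) :: complex)"
        using that by (rule binomial_fact)
      show ?thesis unfolding f_def g_def 1 2 power_minus[of w i]
        by (simp add: scaleR_conv_of_real field_simps)
    qed
    hence "(\<Sum>i\<le>n. f i * g (n - i)) =
        w ^ n / fact n * (\<Sum>i\<le>n. (-1) ^ i * of_nat (n choose i) * (pochhammer a i / pochhammer c i))"
      unfolding sum_distrib_left by (intro sum.cong) auto
    thus ?thesis unfolding sum_binomial_pochhammer_quotient[OF c] by (simp add: mult_ac)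
  qed
  have "(\<lambda>n. pochhammer (c - a) n / pochhammer c n * w ^ n / fact n) sums (kummer_1F1 a c (- w) * exp w)"
    using Cauchy_product_sums[OF f(2) g(2)] f(1) g(1) unfolding eq by (simp add: sums_iff)
  with kummer_1F1_sums[OF c, of "c - a" w] show ?thesis
    by (subst mult.commute) (rule sums_unique2[symmetric])
qed

text \<open>The induction step is (2k + 3)(2k + 2) = 4 (k + 1)(3/2 + k).\<close>

lemma fact_odd_eq_pochhammer:
  "(fact (2 * k + 1) :: complex) = 4 ^ k * fact k * pochhammer (3 / 2) k"
proof (induction k)
  case (Suc k)
  have "(fact (2 * Suc k + 1) :: complex) = of_nat (2 * k + 3) * of_nat (2 * k + 2) * fact (2 * k + 1)"
    by (simp add: fact_reduce numeral_3_eq_3)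
  thus ?case unfolding Suc.IH by (simp add: pochhammer_Suc field_simps)
qed simp

text \<open>The coefficient of t^(2k+1) in exp(-t^2) sinh(t z), that is H_(2k+1)(z/2) / (2k+1)! with
  the Hermite polynomial H_(2k+1).\<close>

definition gauss_sinh_coeff :: "complex \<Rightarrow> nat \<Rightarrow> complex" where
  "gauss_sinh_coeff z k = (\<Sum>j\<le>k. z ^ (2 * j + 1) / fact (2 * j + 1) * ((-1) ^ (k - j) / fact (k - j)))"

text \<open>The series stops at n = k because (-k)_n = 0 beyond. Then (-k)_j = (-1)^j k! / (k-j)!
  and (2j+1)! = 4^j j! (3/2)_j match the summands one by one.\<close>

lemma kummer_1F1_minus_nat:
  "z * kummer_1F1 (- of_nat k) (3 / 2) (z\<^sup>2 / 4) = (-1) ^ k * fact k * gauss_sinh_coeff z k"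
proof -
  let ?f = "\<lambda>n. pochhammer (- of_nat k) n / pochhammer (3 / 2) n * (z\<^sup>2 / 4) ^ n / fact n :: complex"
  have "?f sums (\<Sum>n\<le>k. ?f n)"
    by (rule sums_finite) (auto simp: pochhammer_of_nat_eq_0_iff)
  moreover have "?f sums kummer_1F1 (- of_nat k) (3 / 2) (z\<^sup>2 / 4)"
    by (rule kummer_1F1_sums) simp
  ultimately have "kummer_1F1 (- of_nat k) (3 / 2) (z\<^sup>2 / 4) = (\<Sum>n\<le>k. ?f n)"
    by (intro sums_unique2)
  hence "z * kummer_1F1 (- of_nat k) (3 / 2) (z\<^sup>2 / 4) = z * (\<Sum>n\<le>k. ?f n)"
    by (simp only:)
  also have "\<dots> = (-1) ^ k * fact k * gauss_sinh_coeff z k"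
    unfolding gauss_sinh_coeff_def sum_distrib_left
  proof (rule sum.cong)
    fix j assume "j \<in> {..k}"
    hence j: "j \<le> k" by simp
    have p: "pochhammer (- of_nat k) j = ((-1) ^ j * fact k / fact (k - j) :: complex)"
    proof -
      have "(fact k / (fact j * fact (k - j)) :: complex) = (-1) ^ j * pochhammer (- of_nat k) j / fact j"
        using binomial_fact[OF j, where 'a = complex] by (simp add: binomial_gbinomial gbinomial_pochhammer)
      thus ?thesis by (cases "even j") (auto simp: field_simps)
    qed
    have s: "(-1) ^ j = ((-1) ^ k * (-1) ^ (k - j) :: complex)"
      using j by (auto simp: minus_one_power_iff)
    have "pochhammer (3 / 2) j \<noteq> (0 :: complex)"
      using fact_odd_eq_pochhammer[of j] fact_nonzero[of "2 * j + 1", where 'a = complex] by auto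
    thus "z * ?f j = (-1) ^ k * fact k * (z ^ (2 * j + 1) / fact (2 * j + 1) * ((-1) ^ (k - j) / fact (k - j)))"
      unfolding p s fact_odd_eq_pochhammer
      by (simp add: power_divide power_mult[symmetric] field_simps)
  qed simp
  finally show ?thesis .
qed

text \<open>Kummer's transformation has c - a = 3/2 - (k + 3/2) = -k, which gives the Taylor
  coefficient. The Gamma value is sqrt pi (1/2)_m, and (2k+1)! = 2 * 4^k k! (1/2)_m absorbs the
  remaining constants. The right side is twice that coefficient times the Bose integral without its
  zeta factor.\<close>

lemma expansion_coeff_Suc:
  fixes z :: complex and k :: nat
  defines "m \<equiv> Suc k"
  shows "- z / of_real (sqrt pi) * exp (z\<^sup>2 / 4) * (-1) ^ m / of_real pi ^ (2 * m) *
           (Gamma (of_nat m + 1 / 2) * kummer_1F1 (of_nat m + 1 / 2) (3 / 2) (- z\<^sup>2 / 4)) =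
         2 * gauss_sinh_coeff z k * (fact (2 * k + 1) / of_real (2 * pi) ^ (2 * m))"
proof -
  have "(1 / 2 :: complex) \<notin> \<int>\<^sub>\<le>\<^sub>0"
    by (auto elim!: nonpos_Ints_cases simp: complex_eq_iff)
  hence "pochhammer (1 / 2) m = Gamma (1 / 2 + of_nat m) / Gamma (1 / 2 :: complex)"
    by (rule pochhammer_Gamma)
  hence gam: "Gamma (of_nat m + 1 / 2 :: complex) = of_real (sqrt pi) * pochhammer (1 / 2) m"
    by (simp add: Gamma_one_half_complex add.commute)
  have "pochhammer (1 / 2 :: complex) m = 1 / 2 * pochhammer (3 / 2) k"
    unfolding m_def pochhammer_rec by simp
  hence fac: "(fact (2 * k + 1) :: complex) = 2 * 4 ^ k * fact k * pochhammer (1 / 2) m"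
    unfolding fact_odd_eq_pochhammer by (simp add: mult_ac)
  have "exp (z\<^sup>2 / 4) * kummer_1F1 (of_nat m + 1 / 2) (3 / 2) (- (z\<^sup>2 / 4)) =
        kummer_1F1 (- of_nat k) (3 / 2) (z\<^sup>2 / 4)"
    by (subst kummer_transformation) (auto simp: m_def)
  hence kum: "z * (exp (z\<^sup>2 / 4) * kummer_1F1 (of_nat m + 1 / 2) (3 / 2) (- z\<^sup>2 / 4)) =
        (-1) ^ k * fact k * gauss_sinh_coeff z k"
    by (simp add: kummer_1F1_minus_nat)
  have "- z / of_real (sqrt pi) * exp (z\<^sup>2 / 4) * (-1) ^ m / of_real pi ^ (2 * m) *
           (Gamma (of_nat m + 1 / 2) * kummer_1F1 (of_nat m + 1 / 2) (3 / 2) (- z\<^sup>2 / 4)) =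
        (-1) ^ k / of_real pi ^ (2 * m) * pochhammer (1 / 2) m *
          (z * (exp (z\<^sup>2 / 4) * kummer_1F1 (of_nat m + 1 / 2) (3 / 2) (- z\<^sup>2 / 4)))"
    unfolding gam by (simp add: m_def)
  also have "\<dots> = fact k * pochhammer (1 / 2) m * gauss_sinh_coeff z k / of_real pi ^ (2 * m)"
    unfolding kum by (cases "even k") auto
  also have "\<dots> = 2 * gauss_sinh_coeff z k * (fact (2 * k + 1) / of_real (2 * pi) ^ (2 * m))"
  proof -
    have 4: "(4 :: complex) ^ k = (2 ^ k)\<^sup>2"
      by (simp add: power2_eq_square flip: power_mult_distrib)
    show ?thesis
      unfolding fac 4 by (simp add: m_def power_mult_distrib power_mult[of 2] field_simps)
  qed
  finally show ?thesis .
qed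

section \<open>The half-line integral of G, its Taylor series and a global remainder bound\<close>

section \<open>The Gaussian hyperbolic sine\<close>

text \<open>Termwise integration, justified by summability of the L1 norms \<open>J\<close>.\<close>

lemma has_bochner_integral_sums:
  fixes f :: "nat \<Rightarrow> 'a \<Rightarrow> 'b::{banach, second_countable_topology}"
  assumes f: "\<And>n. has_bochner_integral M (f n) (I n)"
    and nf: "\<And>n. has_bochner_integral M (\<lambda>x. norm (f n x)) (J n)"
    and J: "summable J" and S: "I sums S"
    and F: "\<And>x. (\<lambda>n. f n x) sums F x" and nF: "\<And>x. summable (\<lambda>n. norm (f n x))"
  shows "has_bochner_integral M F S"
proof -
  have 1: "integrable M (f n)" for n using f by (auto simp: has_bochner_integral_iff)
  have 2: "AE x in M. summable (\<lambda>n. norm (f n x))" using nF by simp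
  have 3: "summable (\<lambda>n. \<integral>x. norm (f n x) \<partial>M)"
    using J nf by (simp add: has_bochner_integral_iff)
  have "F = (\<lambda>x. \<Sum>n. f n x)" using F by (auto simp: sums_iff)
  moreover have "S = (\<Sum>n. integral\<^sup>L M (f n))"
    using S f by (simp add: has_bochner_integral_iff sums_iff)
  ultimately show ?thesis
    using integrable_suminf[OF 1 2 3] integral_suminf[OF 1 2 3] by (simp add: has_bochner_integral_iff)
qed

lemma sinh_odd_sums:
  fixes w :: "'a :: {real_normed_field, banach}"
  shows "(\<lambda>k. w ^ (2 * k + 1) / fact (2 * k + 1)) sums sinh w"
proof -
  let ?f = "\<lambda>n. if even n then 0 else w ^ n /\<^sub>R fact n"
  have "(\<lambda>k. ?f (2 * k + 1)) sums sinh w \<longleftrightarrow> ?f sums sinh w"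
  proof (rule sums_mono_reindex)
    show "strict_mono (\<lambda>k::nat. 2 * k + 1)" by (auto simp: strict_mono_def)
    fix n :: nat assume "n \<notin> range (\<lambda>k. 2 * k + 1)"
    hence "even n" by (metis oddE rangeI)
    thus "?f n = 0" by simp
  qed
  moreover have "?f (2 * k + 1) = w ^ (2 * k + 1) / fact (2 * k + 1)" for k
    by (simp add: scaleR_conv_of_real field_simps del: fact_Suc power_Suc)
  ultimately show ?thesis using sinh_converges[of w] by simp
qed

lemma summable_norm_sinh_odd:
  fixes w :: "'a :: {real_normed_field, banach}"
  shows "summable (\<lambda>k. norm (w ^ (2 * k + 1) / fact (2 * k + 1)))"
  using sums_summable[OF sinh_odd_sums[of "norm w"]]
  by (simp only: norm_divide norm_power norm_fact)

definition gauss_sinh :: "complex \<Rightarrow> real \<Rightarrow> complex" where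
  "gauss_sinh z t = of_real (exp (- t\<^sup>2)) * sinh (of_real t * z)"

lemma gauss_sinh_minus: "gauss_sinh z (- t) = - gauss_sinh z t"
  by (simp add: gauss_sinh_def)

lemma borel_measurable_gauss_sinh [measurable]: "gauss_sinh z \<in> borel_measurable borel"
  unfolding gauss_sinh_def[abs_def] sinh_def
  by (intro borel_measurable_continuous_onI continuous_intros)

text \<open>Only sinh is expanded; the Gaussian factor stays, and its odd half-line moments are
  k!/2.\<close>

lemma has_bochner_integral_gauss_sinh:
  "has_bochner_integral lborel (\<lambda>t. indicator {0..} t *\<^sub>R gauss_sinh z t)
     (z / 2 * kummer_1F1 1 (3 / 2) (z\<^sup>2 / 4))"
proof -
  define c where "c k = z ^ (2 * k + 1) / fact (2 * k + 1)" for k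
  define u where "u k t = indicator {0..} t *\<^sub>R (exp (- t\<^sup>2) * t ^ (2 * k + 1))" for k and t :: real
  have u: "has_bochner_integral lborel (u k) (fact k / 2)" for k
    unfolding u_def by (rule gaussian_moment_odd_pos)
  have u_nonneg: "u k t \<ge> 0" for k t
    by (auto simp: u_def indicator_def)
  \<comment> \<open>The quotient \<open>pochhammer 1 k / fact k\<close> equals 1; it exhibits the
    series as a 1F1 with numerator parameter 1.\<close>
  have coeff: "(fact k / 2) *\<^sub>R c k = z / 2 * (pochhammer 1 k / pochhammer (3 / 2) k * (z\<^sup>2 / 4) ^ k / fact k)" for k
    unfolding c_def fact_odd_eq_pochhammer pochhammer_fact[symmetric]
    by (simp add: scaleR_conv_of_real power_divide power_mult[symmetric] field_simps)
  show ?thesis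
  proof (rule has_bochner_integral_sums)
    show "has_bochner_integral lborel (\<lambda>t. u k t *\<^sub>R c k) ((fact k / 2) *\<^sub>R c k)" for k
      by (intro has_bochner_integral_scaleR_left u)
    have "has_bochner_integral lborel (\<lambda>t. u k t * norm (c k)) (fact k / 2 * norm (c k))" for k
      by (intro has_bochner_integral_mult_left u)
    thus "has_bochner_integral lborel (\<lambda>t. norm (u k t *\<^sub>R c k)) (norm ((fact k / 2) *\<^sub>R c k))" for k
      using u_nonneg by simp
    show "(\<lambda>k. (fact k / 2) *\<^sub>R c k) sums (z / 2 * kummer_1F1 1 (3 / 2) (z\<^sup>2 / 4))"
      unfolding coeff by (intro sums_mult kummer_1F1_sums) simp
    show "summable (\<lambda>k. norm ((fact k / 2) *\<^sub>R c k))"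
      unfolding coeff norm_mult[of "z / 2"] by (intro summable_mult summable_norm_kummer_1F1) simp
    fix t :: real
    have eq: "u k t *\<^sub>R c k = (indicator {0..} t * exp (- t\<^sup>2)) *\<^sub>R ((of_real t * z) ^ (2 * k + 1) / fact (2 * k + 1))" for k
      by (simp add: u_def c_def scaleR_conv_of_real power_mult_distrib del: fact_Suc)
    show "(\<lambda>k. u k t *\<^sub>R c k) sums (indicator {0..} t *\<^sub>R gauss_sinh z t)"
      using sums_scaleR_right[OF sinh_odd_sums[of "of_real t * z"], of "indicator {0..} t * exp (- t\<^sup>2)"]
      unfolding eq by (simp add: gauss_sinh_def scaleR_conv_of_real mult.assoc)
    show "summable (\<lambda>k. norm (u k t *\<^sub>R c k))"
      unfolding eq norm_scaleR by (intro summable_mult summable_norm_sinh_odd)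
  qed
qed

text \<open>Cauchy product of the odd series of sinh with the series of exp(-t^2).\<close>

lemma gauss_sinh_sums:
  "(\<lambda>k. gauss_sinh_coeff z k * of_real t ^ (2 * k + 1)) sums gauss_sinh z t"
proof -
  define a where "a j = (of_real t * z) ^ (2 * j + 1) / fact (2 * j + 1)" for j
  define b :: "nat \<Rightarrow> complex" where "b j = of_real (- t\<^sup>2) ^ j /\<^sub>R fact j" for j
  have a: "a sums sinh (of_real t * z)" "summable (\<lambda>j. norm (a j))"
    unfolding a_def by (intro sinh_odd_sums summable_norm_sinh_odd)+
  have b: "b sums of_real (exp (- t\<^sup>2))" "summable (\<lambda>j. norm (b j))"
    unfolding b_def exp_of_real[symmetric] by (intro exp_converges summable_norm_exp)+
  have "(\<Sum>j\<le>k. a j * b (k - j)) = gauss_sinh_coeff z k * of_real t ^ (2 * k + 1)" for k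
    unfolding gauss_sinh_coeff_def sum_distrib_right
  proof (rule sum.cong)
    fix j assume "j \<in> {..k}"
    hence "2 * k + 1 = (2 * j + 1) + 2 * (k - j)" by simp
    hence t: "(of_real t :: complex) ^ (2 * k + 1) = of_real t ^ (2 * j + 1) * (of_real t ^ 2) ^ (k - j)"
      by (simp only: power_add power_mult)
    have m: "(- (of_real t)\<^sup>2) ^ (k - j) = (-1) ^ (k - j) * ((of_real t)\<^sup>2 :: complex) ^ (k - j)"
      by (rule power_minus)
    show "a j * b (k - j) = z ^ (2 * j + 1) / fact (2 * j + 1) * ((- 1) ^ (k - j) / fact (k - j)) * of_real t ^ (2 * k + 1)"
      unfolding a_def b_def t
      by (simp add: scaleR_conv_of_real power_mult_distrib m field_simps del: fact_Suc power_Suc)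
  qed simp
  with Cauchy_product_sums[OF a(2) b(2)] a(1) b(1) show ?thesis
    by (simp add: sums_iff gauss_sinh_def mult.commute)
qed

text \<open>Convergence of the Taylor series at t = 2, a power series in t^2 up to the factor t,
  forces absolute convergence at t = 1.\<close>

lemma summable_norm_gauss_sinh_coeff: "summable (\<lambda>k. norm (gauss_sinh_coeff z k))"
proof -
  have "(\<lambda>k. gauss_sinh_coeff z k * of_real 2 ^ (2 * k + 1) / 2) sums (gauss_sinh z 2 / 2)"
    by (intro sums_divide gauss_sinh_sums)
  hence "summable (\<lambda>k. gauss_sinh_coeff z k * 4 ^ k)"
    by (simp add: sums_iff power_mult)
  from powser_insidea[OF this, of 1] show ?thesis by simp
qed

text \<open>Completing the square: -t^2 + |t| |z| = |z|^2 / 4 - (|t| - |z|/2)^2.\<close>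

lemma norm_gauss_sinh_le: "norm (gauss_sinh z t) \<le> exp ((norm z)\<^sup>2 / 4)"
proof -
  have "norm (sinh (of_real t * z)) \<le> (exp (\<bar>t\<bar> * norm z) + exp (\<bar>t\<bar> * norm z)) / 2"
  proof -
    have "norm (exp (of_real t * z) - exp (- (of_real t * z))) \<le> norm (exp (of_real t * z)) + norm (exp (- (of_real t * z)))"
      by (rule norm_triangle_ineq4)
    also have "\<dots> \<le> exp (\<bar>t\<bar> * norm z) + exp (\<bar>t\<bar> * norm z)"
      using norm_exp[of "of_real t * z"] norm_exp[of "- (of_real t * z)"]
      by (intro add_mono) (simp_all add: norm_mult)
    finally show ?thesis by (simp add: sinh_def)
  qed
  hence "norm (gauss_sinh z t) \<le> exp (- t\<^sup>2) * exp (\<bar>t\<bar> * norm z)"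
    by (simp add: gauss_sinh_def norm_mult)
  also have "\<dots> = exp ((norm z)\<^sup>2 / 4 - (\<bar>t\<bar> - norm z / 2)\<^sup>2)"
    by (simp add: power2_eq_square algebra_simps flip: exp_add)
  also have "\<dots> \<le> exp ((norm z)\<^sup>2 / 4)" by simp
  finally show ?thesis .
qed

text \<open>For t <= 1 the remainder is the series tail, whose powers are at most t^(2N+1). For t >=
  1 the function is bounded and all powers in the polynomial are below t^(2N+1). One constant serves
  all \<open>N\<close>.\<close>

lemma gauss_sinh_remainder:
  obtains C where "C \<ge> 0" "\<And>N t. t \<ge> 0 \<Longrightarrow>
    norm (gauss_sinh z t - (\<Sum>k<N. gauss_sinh_coeff z k * of_real t ^ (2 * k + 1))) \<le> C * t ^ (2 * N + 1)"
proof -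
  let ?c = "gauss_sinh_coeff z"
  define S where "S = (\<Sum>k. norm (?c k))"
  have S: "S \<ge> 0" unfolding S_def by (intro suminf_nonneg summable_norm_gauss_sinh_coeff) simp
  define C where "C = exp ((norm z)\<^sup>2 / 4) + S"
  show ?thesis
  proof
    show "C \<ge> 0" using S by (simp add: C_def)
    fix N :: nat and t :: real assume t: "t \<ge> 0"
    show "norm (gauss_sinh z t - (\<Sum>k<N. ?c k * of_real t ^ (2 * k + 1))) \<le> C * t ^ (2 * N + 1)"
    proof (cases "t \<le> 1")
      case True
      have eq: "gauss_sinh z t - (\<Sum>k<N. ?c k * of_real t ^ (2 * k + 1)) =
            (\<Sum>k. ?c (k + N) * of_real t ^ (2 * (k + N) + 1))"
        using sums_unique[OF sums_split_initial_segment[OF gauss_sinh_sums[of z t], of N]] by simp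
      have sm: "summable (\<lambda>k. norm (?c (k + N)))"
        by (subst summable_iff_shift) (rule summable_norm_gauss_sinh_coeff)
      have "norm (\<Sum>k. ?c (k + N) * of_real t ^ (2 * (k + N) + 1)) \<le> (\<Sum>k. norm (?c (k + N)) * t ^ (2 * N + 1))"
      proof (rule norm_suminf_le)
        show "norm (?c (k + N) * of_real t ^ (2 * (k + N) + 1)) \<le> norm (?c (k + N)) * t ^ (2 * N + 1)" for k
          unfolding norm_mult norm_power norm_of_real abs_of_nonneg[OF t]
          by (intro mult_left_mono power_decreasing) (use t True in auto)
      qed (intro summable_mult2 sm)
      also have "\<dots> = (\<Sum>k. norm (?c (k + N))) * t ^ (2 * N + 1)"
        by (rule suminf_mult2[OF sm, symmetric])
      also have "\<dots> \<le> C * t ^ (2 * N + 1)"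
      proof (rule mult_right_mono)
        have "(\<Sum>k. norm (?c (k + N))) = S - (\<Sum>k<N. norm (?c k))"
          unfolding S_def by (rule suminf_minus_initial_segment[OF summable_norm_gauss_sinh_coeff])
        also have "\<dots> \<le> S" by (simp add: sum_nonneg)
        finally show "(\<Sum>k. norm (?c (k + N))) \<le> C" unfolding C_def by (simp add: add_increasing)
      qed (use t in simp)
      finally show ?thesis unfolding eq .
    next
      case False
      hence t1: "t \<ge> 1" by simp
      have "norm (gauss_sinh z t - (\<Sum>k<N. ?c k * of_real t ^ (2 * k + 1))) \<le>
            norm (gauss_sinh z t) + (\<Sum>k<N. norm (?c k * of_real t ^ (2 * k + 1)))"
        by (rule order.trans[OF norm_triangle_ineq4]) (intro add_left_mono norm_sum)
      also have "\<dots> \<le> exp ((norm z)\<^sup>2 / 4) * t ^ (2 * N + 1) + (\<Sum>k<N. norm (?c k) * t ^ (2 * N + 1))"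
      proof (intro add_mono sum_mono)
        have "exp ((norm z)\<^sup>2 / 4) * 1 \<le> exp ((norm z)\<^sup>2 / 4) * t ^ (2 * N + 1)"
          by (intro mult_left_mono one_le_power t1) simp
        hence "exp ((norm z)\<^sup>2 / 4) \<le> exp ((norm z)\<^sup>2 / 4) * t ^ (2 * N + 1)"
          by (simp only: mult_1_right)
        with norm_gauss_sinh_le show "norm (gauss_sinh z t) \<le> exp ((norm z)\<^sup>2 / 4) * t ^ (2 * N + 1)"
          by (rule order.trans)
        fix k assume "k \<in> {..<N}"
        thus "norm (?c k * of_real t ^ (2 * k + 1)) \<le> norm (?c k) * t ^ (2 * N + 1)"
          unfolding norm_mult norm_power norm_of_real abs_of_nonneg[OF t]
          by (intro mult_left_mono power_increasing t1) auto
      qed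
      also have "\<dots> = (exp ((norm z)\<^sup>2 / 4) + (\<Sum>k<N. norm (?c k))) * t ^ (2 * N + 1)"
        by (simp only: sum_distrib_right distrib_right)
      also have "\<dots> \<le> C * t ^ (2 * N + 1)"
      proof (rule mult_right_mono)
        have "(\<Sum>k<N. norm (?c k)) \<le> S"
          unfolding S_def by (intro sum_le_suminf summable_norm_gauss_sinh_coeff) auto
        thus "exp ((norm z)\<^sup>2 / 4) + (\<Sum>k<N. norm (?c k)) \<le> C" by (simp add: C_def)
      qed (use t in simp)
      finally show ?thesis .
    qed
  qed
qed

section \<open>Moments of the Bose weight as zeta values\<close>

section \<open>Bose integrals\<close>

text \<open>The factorial integral for l = 1, followed by the substitution x -> l x.\<close>

lemma has_bochner_integral_power_exp:
  assumes l: "l > 0"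
  shows "has_bochner_integral lborel (\<lambda>x::real. indicator {0..} x *\<^sub>R (x ^ m * exp (- (l * x)))) (fact m / l ^ (m + 1))"
proof -
  have "has_bochner_integral lborel (\<lambda>x::real. indicator {0..} x *\<^sub>R (x ^ m * exp (- x))) (fact m)"
  proof (rule has_bochner_integral_nn_integral)
    show "(\<integral>\<^sup>+ x. ennreal (indicator {0..} x *\<^sub>R (x ^ m * exp (- x))) \<partial>lborel) = ennreal (fact m)"
    proof -
      have "(\<integral>\<^sup>+ x. ennreal (indicator {0..} x *\<^sub>R (x ^ m * exp (- x))) \<partial>lborel) =
            (\<integral>\<^sup>+ x. ennreal (x ^ m * exp (- x)) * indicator {0..} x \<partial>lborel)"
        by (intro nn_integral_cong) (auto simp: indicator_def)
      thus ?thesis using nn_intergal_power_times_exp_Ici[of m] by simp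
    qed
  qed (auto simp: indicator_def)
  hence "has_bochner_integral lborel (\<lambda>x. indicator {0..} (0 + l * x) *\<^sub>R ((0 + l * x) ^ m * exp (- (0 + l * x)))) (fact m /\<^sub>R \<bar>l\<bar>)"
    using l by (subst (asm) lborel_has_bochner_integral_real_affine_iff[of l _ _ 0]) simp_all
  from has_bochner_integral_mult_right[OF this, of "1 / l ^ m"] show ?thesis
    using l by (elim has_bochner_integral_cong[THEN iffD1, rotated -1])
       (auto simp: indicator_def zero_le_mult_iff power_mult_distrib field_simps)
qed

text \<open>The closed form m! zeta(m+1) / (2 pi)^(m+1), with zeta as a real series; that it is the
  integral its name suggests is proved below.\<close>

definition bose_integral :: "nat \<Rightarrow> real" where
  "bose_integral m = fact m / (2 * pi) ^ (m + 1) * (\<Sum>n. 1 / real (Suc n) ^ (m + 1))"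

lemma summable_inverse_power_Suc: "m \<ge> 1 \<Longrightarrow> summable (\<lambda>n. 1 / real (Suc n) ^ (m + 1))"
  using inverse_power_summable[of "m + 1", where 'a = real]
  by (subst summable_Suc_iff [where f = "\<lambda>n. 1 / real n ^ (m + 1)"]) (simp add: field_simps)

text \<open>Expand 1/(e^y - 1) into the geometric series of e^(-(n+1)y). All terms are nonnegative,
  so the integrals are their own L1 norms.\<close>

lemma has_bochner_integral_bose:
  assumes m: "m \<ge> 1"
  shows "has_bochner_integral lborel (\<lambda>x. indicator {0..} x *\<^sub>R (x ^ m / (exp (2 * pi * x) - 1))) (bose_integral m)"
proof -
  define f where "f n x = indicator {0..} x *\<^sub>R (x ^ m * exp (- (2 * pi * real (Suc n) * x)))" for n and x :: real
  have f_nonneg: "f n x \<ge> 0" for n x by (auto simp: f_def indicator_def)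
  have I: "has_bochner_integral lborel (f n) (fact m / (2 * pi * real (Suc n)) ^ (m + 1))" for n
    unfolding f_def by (rule has_bochner_integral_power_exp) simp
  have eq: "fact m / (2 * pi * real (Suc n)) ^ (m + 1) = fact m / (2 * pi) ^ (m + 1) * (1 / real (Suc n) ^ (m + 1))" for n
    by (simp only: power_mult_distrib[of "2 * pi"] times_divide_times_eq mult_1_right)
  have S: "(\<lambda>n. fact m / (2 * pi * real (Suc n)) ^ (m + 1)) sums bose_integral m"
    unfolding eq bose_integral_def by (intro sums_mult summable_sums summable_inverse_power_Suc m)
  have F: "(\<lambda>n. f n x) sums (indicator {0..} x *\<^sub>R (x ^ m / (exp (2 * pi * x) - 1)))" for x
  proof (cases "x > 0")
    case False
    \<comment> \<open>At x = 0 this uses 0^m = 0, which holds as m >= 1.\<close>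
    hence "f n x = 0" for n using m by (cases "x = 0") (auto simp: f_def indicator_def)
    moreover have "indicator {0..} x *\<^sub>R (x ^ m / (exp (2 * pi * x) - 1)) = 0"
      using False m by (cases "x = 0") (auto simp: indicator_def)
    ultimately show ?thesis by (simp only: sums_zero)
  next
    case True
    define q where "q = exp (- (2 * pi * x))"
    have q: "norm q < 1" using True by (simp add: q_def)
    have "(\<lambda>n. (x ^ m * q) * q ^ n) sums ((x ^ m * q) * (1 / (1 - q)))"
      by (intro sums_mult geometric_sums q)
    also have "(x ^ m * q) * (1 / (1 - q)) = indicator {0..} x *\<^sub>R (x ^ m / (exp (2 * pi * x) - 1))"
      using True by (simp add: q_def exp_minus field_simps)
    also have "(\<lambda>n. (x ^ m * q) * q ^ n) = (\<lambda>n. f n x)"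
      using True by (auto simp: f_def q_def algebra_simps simp flip: exp_of_nat_mult exp_add)
    finally show ?thesis .
  qed
  show ?thesis
  proof (rule has_bochner_integral_sums[OF I _ _ S F])
    show "has_bochner_integral lborel (\<lambda>x. norm (f n x)) (fact m / (2 * pi * real (Suc n)) ^ (m + 1))" for n
      using I f_nonneg by simp
    show "summable (\<lambda>n. fact m / (2 * pi * real (Suc n)) ^ (m + 1))" using S by (rule sums_summable)
    show "summable (\<lambda>n. norm (f n x))" for x
      using sums_summable[OF F] f_nonneg by simp
  qed
qed

section \<open>Folding the line integral and estimating the error\<close>

lemma bose_weight_reflect:
  assumes "y \<noteq> 0"
  shows "1 + 1 / (exp y - 1) = - (1 / (exp (- y) - 1 :: real))"
proof -
  have "exp y \<noteq> 1" using assms by simp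
  thus ?thesis by (simp add: exp_minus field_simps)
qed

text \<open>By oddness and the reflection of the weight, the negative half line contributes A + B
  and the positive one B.\<close>

lemma has_bochner_integral_odd_bose:
  fixes G :: "real \<Rightarrow> complex"
  assumes odd: "\<And>x. G (- x) = - G x"
    and A: "has_bochner_integral lborel (\<lambda>x. indicator {0..} x *\<^sub>R G x) A"
    and B: "has_bochner_integral lborel (\<lambda>x. indicator {0..} x *\<^sub>R (G x / of_real (exp (2 * pi * x) - 1))) B"
  shows "has_bochner_integral lborel (\<lambda>x. G x / of_real (exp (2 * pi * x) - 1)) (A + 2 * B)"
proof -
  \<comment> \<open>The integrand on x < 0 after the reflection x -> -x. At x = 0 the quotients are
    0 by the division convention, and \<open>G 0 = 0\<close> disposes of the remaining term.\<close>
  define f where "f x = indicator {0..} x *\<^sub>R G x + indicator {0..} x *\<^sub>R (G x / of_real (exp (2 * pi * x) - 1))" for x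
  have "G 0 = 0" using odd[of 0] by simp
  have "has_bochner_integral lborel f (A + B)"
    unfolding f_def by (intro has_bochner_integral_add A B)
  hence "has_bochner_integral lborel (\<lambda>x. f (0 + (-1) * x)) ((A + B) /\<^sub>R \<bar>-1\<bar>)"
    by (subst (asm) lborel_has_bochner_integral_real_affine_iff[of "-1" _ _ 0]) simp_all
  from has_bochner_integral_add[OF this B]
  have "has_bochner_integral lborel (\<lambda>x. f (- x) + indicator {0..} x *\<^sub>R (G x / of_real (exp (2 * pi * x) - 1))) (A + 2 * B)"
    by (simp add: algebra_simps)
  moreover have "f (- x) + indicator {0..} x *\<^sub>R (G x / of_real (exp (2 * pi * x) - 1)) = G x / of_real (exp (2 * pi * x) - 1)" for x
  proof (cases "x < 0")
    case True
    have "f (- x) = - G x * of_real (1 + 1 / (exp (- (2 * pi * x)) - 1))"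
      using True by (simp add: f_def odd algebra_simps)
    also have "1 + 1 / (exp (- (2 * pi * x)) - 1) = - (1 / (exp (2 * pi * x) - 1))"
      using bose_weight_reflect[of "- (2 * pi * x)"] True by simp
    finally show ?thesis using True by simp
  next
    case False
    thus ?thesis using \<open>G 0 = 0\<close> by (cases "x = 0") (auto simp: f_def)
  qed
  ultimately show ?thesis by simp
qed

text \<open>The Taylor remainder at t = s x, divided by the Bose weight's denominator, is integrated
  over the half line; \<open>s\<close> stands for sqrt alpha.\<close>

lemma gauss_sinh_bose_integral_estimate:
  obtains C where "C \<ge> 0" "\<And>N s. s > 0 \<Longrightarrow>
    norm ((\<integral>x. gauss_sinh z (s * x) / of_real (exp (2 * pi * x) - 1) \<partial>lborel) -
      (z / 2 * kummer_1F1 1 (3 / 2) (z\<^sup>2 / 4) / of_real s +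
        2 * (\<Sum>k<N. gauss_sinh_coeff z k * of_real (s ^ (2 * k + 1) * bose_integral (2 * k + 1))))) \<le>
    C * s ^ (2 * N + 1) * bose_integral (2 * N + 1)"
proof -
  obtain C where C: "C \<ge> 0" "\<And>N t. t \<ge> 0 \<Longrightarrow>
    norm (gauss_sinh z t - (\<Sum>k<N. gauss_sinh_coeff z k * of_real t ^ (2 * k + 1))) \<le> C * t ^ (2 * N + 1)"
    using gauss_sinh_remainder by blast
  show ?thesis
  proof
    \<comment> \<open>The Bose part enters the folded integral twice, which doubles the
      constant.\<close>
    show "2 * C \<ge> 0" using C by simp
    fix N :: nat and s :: real assume s: "s > 0"
    define A where "A = z / 2 * kummer_1F1 1 (3 / 2) (z\<^sup>2 / 4)"
    define e where "e x = exp (2 * pi * x) - 1" for x :: real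
    define b where "b m x = indicator {0..} x *\<^sub>R (x ^ m / e x)" for m and x :: real
    define h where "h x = indicator {0..} x *\<^sub>R (gauss_sinh z (s * x) / of_real (e x))" for x
    have e_nonneg: "e x \<ge> 0" if "x \<ge> 0" for x using that by (simp add: e_def)
    have b: "has_bochner_integral lborel (b (2 * k + 1)) (bose_integral (2 * k + 1))" for k
      unfolding b_def e_def by (rule has_bochner_integral_bose) simp
    have "has_bochner_integral lborel (\<lambda>x. indicator {0..} (0 + s * x) *\<^sub>R gauss_sinh z (0 + s * x)) (A /\<^sub>R \<bar>s\<bar>)"
      using has_bochner_integral_gauss_sinh[of z] s unfolding A_def
      by (subst (asm) lborel_has_bochner_integral_real_affine_iff[of s _ _ 0]) simp_all
    hence A: "has_bochner_integral lborel (\<lambda>x. indicator {0..} x *\<^sub>R gauss_sinh z (s * x)) (A / of_real s)"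
      using s by (elim has_bochner_integral_cong[THEN iffD1, rotated -1])
        (auto simp: indicator_def zero_le_mult_iff scaleR_conv_of_real field_simps)
    \<comment> \<open>Used twice: M = 0 yields integrability of \<open>h\<close>, M = N the error
      bound.\<close>
    have h_bound: "norm (h x - (\<Sum>k<M. gauss_sinh_coeff z k * of_real (s ^ (2 * k + 1)) * of_real (b (2 * k + 1) x))) \<le>
        C * s ^ (2 * M + 1) * b (2 * M + 1) x" for M x
    proof (cases "x \<ge> 0")
      case True
      have "h x - (\<Sum>k<M. gauss_sinh_coeff z k * of_real (s ^ (2 * k + 1)) * of_real (b (2 * k + 1) x)) =
            (gauss_sinh z (s * x) - (\<Sum>k<M. gauss_sinh_coeff z k * of_real (s * x) ^ (2 * k + 1))) / of_real (e x)"
        using True by (simp add: h_def b_def diff_divide_distrib sum_divide_distrib power_mult_distrib mult.assoc del: power_Suc)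
      also have "norm \<dots> \<le> C * (s * x) ^ (2 * M + 1) / e x"
        unfolding norm_divide norm_of_real abs_of_nonneg[OF e_nonneg[OF True]]
        by (intro divide_right_mono C(2) e_nonneg True) (use s True in simp)
      also have "\<dots> = C * s ^ (2 * M + 1) * b (2 * M + 1) x"
        using True by (simp add: b_def power_mult_distrib del: power_Suc)
      finally show ?thesis .
    qed (simp add: h_def b_def)
    have int_b: "integrable lborel (\<lambda>x. C * s ^ (2 * M + 1) * b (2 * M + 1) x)" for M
      using b[of M] by (intro integrable_mult_right) (auto simp: has_bochner_integral_iff)
    have int_h: "integrable lborel h"
    proof (rule Bochner_Integration.integrable_bound[OF int_b[of 0]])
      show "h \<in> borel_measurable lborel" unfolding h_def e_def by measurable
      show "AE x in lborel. norm (h x) \<le> norm (C * s ^ (2 * 0 + 1) * b (2 * 0 + 1) x)"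
        using h_bound[of _ 0] by (intro AE_I2) (auto intro: order.trans[OF _ abs_ge_self])
    qed
    define B where "B = integral\<^sup>L lborel h"
    define P where "P x = (\<Sum>k<N. gauss_sinh_coeff z k * of_real (s ^ (2 * k + 1)) * of_real (b (2 * k + 1) x))" for x
    have P: "has_bochner_integral lborel P
        (\<Sum>k<N. gauss_sinh_coeff z k * of_real (s ^ (2 * k + 1)) * of_real (bose_integral (2 * k + 1)))"
      unfolding P_def
      by (intro has_bochner_integral_sum has_bochner_integral_mult_right has_bochner_integral_of_real b)
    have "norm (integral\<^sup>L lborel (\<lambda>x. h x - P x)) \<le> integral\<^sup>L lborel (\<lambda>x. C * s ^ (2 * N + 1) * b (2 * N + 1) x)"
    proof (rule Bochner_Integration.integral_norm_bound_integral[OF _ int_b])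
      show "integrable lborel (\<lambda>x. h x - P x)"
        using P int_h by (intro Bochner_Integration.integrable_diff) (auto simp: has_bochner_integral_iff)
      show "norm (h x - P x) \<le> C * s ^ (2 * N + 1) * b (2 * N + 1) x" for x
        unfolding P_def by (rule h_bound)
    qed
    also have "\<dots> = C * s ^ (2 * N + 1) * bose_integral (2 * N + 1)"
      using b[of N] by (simp add: has_bochner_integral_iff)
    also have "integral\<^sup>L lborel (\<lambda>x. h x - P x) =
        B - (\<Sum>k<N. gauss_sinh_coeff z k * of_real (s ^ (2 * k + 1) * bose_integral (2 * k + 1)))"
      using P int_h by (simp add: has_bochner_integral_iff B_def mult.assoc)
    finally have est: "norm (B - (\<Sum>k<N. gauss_sinh_coeff z k * of_real (s ^ (2 * k + 1) * bose_integral (2 * k + 1)))) \<le>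
        C * s ^ (2 * N + 1) * bose_integral (2 * N + 1)" .
    have "has_bochner_integral lborel (\<lambda>x. gauss_sinh z (s * x) / of_real (exp (2 * pi * x) - 1)) (A / of_real s + 2 * B)"
    proof (rule has_bochner_integral_odd_bose[OF _ A])
      show "gauss_sinh z (s * - x) = - gauss_sinh z (s * x)" for x
        using gauss_sinh_minus[of z "s * x"] by simp
      show "has_bochner_integral lborel (\<lambda>x. indicator {0..} x *\<^sub>R (gauss_sinh z (s * x) / of_real (exp (2 * pi * x) - 1))) B"
        using int_h unfolding h_def e_def B_def by (rule has_bochner_integral_integrable)
    qed
    hence I: "(\<integral>x. gauss_sinh z (s * x) / of_real (exp (2 * pi * x) - 1) \<partial>lborel) = A / of_real s + 2 * B"
      by (simp add: has_bochner_integral_iff)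
    have "(A / of_real s + 2 * B) - (A / of_real s + 2 * T) = 2 * (B - T)" for T :: complex
      by (simp add: algebra_simps)
    thus "norm ((\<integral>x. gauss_sinh z (s * x) / of_real (exp (2 * pi * x) - 1) \<partial>lborel) -
      (z / 2 * kummer_1F1 1 (3 / 2) (z\<^sup>2 / 4) / of_real s +
        2 * (\<Sum>k<N. gauss_sinh_coeff z k * of_real (s ^ (2 * k + 1) * bose_integral (2 * k + 1))))) \<le>
      2 * C * s ^ (2 * N + 1) * bose_integral (2 * N + 1)"
      unfolding I A_def[symmetric] using mult_left_mono[OF est, of 2]
      by (simp only: norm_mult) (simp add: mult_ac)
  qed
qed

text \<open>At 2k + 2 > 1 zeta is its Dirichlet series, so the real series becomes a zeta
  value.\<close>

lemma of_real_bose_integral: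
  "of_real (bose_integral (2 * k + 1)) =
     fact (2 * k + 1) / of_real (2 * pi) ^ (2 * Suc k) * riemann_zeta (of_nat (2 * Suc k))"
proof -
  let ?m = "2 * Suc k"
  have "(\<lambda>n. complex_of_real (1 / real (Suc n) ^ ?m)) sums of_real (\<Sum>n. 1 / real (Suc n) ^ ?m)"
    using summable_inverse_power_Suc[of "2 * k + 1"] by (intro sums_of_real summable_sums) simp
  moreover have "of_nat (Suc n) powr (- of_nat ?m) = complex_of_real (1 / real (Suc n) ^ ?m)" for n
    unfolding powr_minus powr_nat by (simp add: inverse_eq_divide del: of_nat_Suc)
  ultimately have "dirichlet_zeta (of_nat ?m) = of_real (\<Sum>n. 1 / real (Suc n) ^ ?m)"
    using dirichlet_zeta_sums[of "of_nat ?m"] by (simp only: sums_iff) simp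
  thus ?thesis
    by (subst riemann_zeta_eq_dirichlet) (simp_all add: bose_integral_def del: power_Suc fact_Suc)
qed

section \<open>Matching the terms and comparing orders in alpha\<close>

section \<open>The asymptotic expansion\<close>

text \<open>Here zeta(0) = -1/2 and Gamma(1/2) = sqrt pi reduce the prefactor to z / (2 s), and
  Kummer's transformation produces the plain half-line integral. Writing alpha = s^2 removes the
  square root.\<close>

lemma expansion_term_0:
  assumes s: "s > 0"
  shows "- z / complex_of_real (sqrt (pi * s\<^sup>2)) * exp (z\<^sup>2 / 4) *
      (riemann_zeta (of_nat (2 * 0)) * Gamma (of_nat 0 + 1 / 2) *
        kummer_1F1 (of_nat 0 + 1 / 2) (3 / 2) (- z\<^sup>2 / 4) * complex_of_real (- s\<^sup>2 / pi\<^sup>2) ^ 0) =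
    z / 2 * kummer_1F1 1 (3 / 2) (z\<^sup>2 / 4) / of_real s"
proof -
  have r: "sqrt (pi * s\<^sup>2) = sqrt pi * s" using s by (simp add: real_sqrt_mult)
  have k: "kummer_1F1 1 (3 / 2) (z\<^sup>2 / 4) = exp (z\<^sup>2 / 4) * kummer_1F1 (1 / 2) (3 / 2) (- z\<^sup>2 / 4)"
    using kummer_transformation[of "3 / 2" "z\<^sup>2 / 4" "1 / 2"] by simp
  have "of_real (sqrt pi) \<noteq> (0 :: complex)" by simp
  thus ?thesis
    unfolding r k using s by (simp add: riemann_zeta_0 Gamma_one_half_complex field_simps)
qed

text \<open>In alpha^(k+1) = s * s^(2k+1) the first factor cancels the 1/s of the prefactor.\<close>

lemma expansion_term_Suc:
  assumes s: "s > 0"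
  shows "- z / complex_of_real (sqrt (pi * s\<^sup>2)) * exp (z\<^sup>2 / 4) *
      (riemann_zeta (of_nat (2 * Suc k)) * Gamma (of_nat (Suc k) + 1 / 2) *
        kummer_1F1 (of_nat (Suc k) + 1 / 2) (3 / 2) (- z\<^sup>2 / 4) * complex_of_real (- s\<^sup>2 / pi\<^sup>2) ^ Suc k) =
    2 * (gauss_sinh_coeff z k * of_real (s ^ (2 * k + 1) * bose_integral (2 * k + 1)))"
proof -
  let ?m = "Suc k"
  let ?Z = "riemann_zeta (of_nat (2 * ?m))" and ?G = "Gamma (of_nat ?m + 1 / 2) :: complex"
    and ?K = "kummer_1F1 (of_nat ?m + 1 / 2) (3 / 2) (- z\<^sup>2 / 4)"
  have r: "complex_of_real (sqrt (pi * s\<^sup>2)) = of_real (sqrt pi) * of_real s"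
    using s by (simp add: real_sqrt_mult)
  have p: "complex_of_real (- s\<^sup>2 / pi\<^sup>2) ^ ?m = (-1) ^ ?m / of_real pi ^ (2 * ?m) * (of_real s * of_real s ^ (2 * k + 1))"
  proof -
    have "complex_of_real (- s\<^sup>2 / pi\<^sup>2) ^ ?m = of_real ((- s\<^sup>2 / pi\<^sup>2) ^ ?m)" by (rule of_real_power[symmetric])
    also have "(- s\<^sup>2 / pi\<^sup>2) ^ ?m = (-1) ^ ?m / pi ^ (2 * ?m) * (s * s ^ (2 * k + 1))"
      by (simp only: power_divide power_minus[of "s\<^sup>2"] power_mult[symmetric]) (simp add: field_simps)
    finally show ?thesis by simp
  qed
  have "- z / (of_real (sqrt pi) * of_real s) * exp (z\<^sup>2 / 4) *
      (?Z * ?G * ?K * ((-1) ^ ?m / of_real pi ^ (2 * ?m) * (of_real s * of_real s ^ (2 * k + 1)))) =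
    (- z / of_real (sqrt pi) * exp (z\<^sup>2 / 4) * (-1) ^ ?m / of_real pi ^ (2 * ?m) * (?G * ?K)) * (?Z * of_real s ^ (2 * k + 1))"
    using s by (simp del: power_Suc of_nat_Suc)
  also have "\<dots> = 2 * gauss_sinh_coeff z k * (fact (2 * k + 1) / of_real (2 * pi) ^ (2 * ?m)) * (?Z * of_real s ^ (2 * k + 1))"
    unfolding expansion_coeff_Suc ..
  also have "\<dots> = 2 * (gauss_sinh_coeff z k * of_real (s ^ (2 * k + 1) * bose_integral (2 * k + 1)))"
    unfolding of_real_mult of_real_bose_integral of_real_power by (simp only: mult_ac)
  finally show ?thesis unfolding r p .
qed

lemma eventually_at_right_0_less: "b > 0 \<Longrightarrow> \<forall>\<^sub>F x in at_right (0::real). 0 < x \<and> x < b"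
  by (auto simp: eventually_at_right_field)

text \<open>The error after the terms m <= N is of order alpha^(N + 1/2), one full power of alpha
  below the comparison function, which has order alpha^(N - 1/2) when z is nonzero.\<close>

theorem theorem4p2:
  fixes z :: complex
  shows "poincare_expansion (at_right (0::real))
    (\<lambda>\<alpha>. \<integral>x. complex_of_real (exp (- \<alpha> * x\<^sup>2)) * sinh (complex_of_real (sqrt \<alpha> * x) * z)
                / complex_of_real (exp (2 * pi * x) - 1) \<partial>lborel)
    (\<lambda>\<alpha>. - z / complex_of_real (sqrt (pi * \<alpha>)) * exp (z\<^sup>2 / 4))
    (\<lambda>m \<alpha>. complex_of_real (- \<alpha> / pi\<^sup>2) ^ m)
    (\<lambda>m. riemann_zeta (of_nat (2 * m)) * Gamma (of_nat m + 1 / 2)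
          * kummer_1F1 (of_nat m + 1 / 2) (3 / 2) (- z\<^sup>2 / 4))"
  unfolding poincare_expansion_def
proof (intro conjI allI)
  fix m :: nat
  show "(\<lambda>\<alpha>. complex_of_real (- \<alpha> / pi\<^sup>2) ^ Suc m) \<in> o[at_right 0](\<lambda>\<alpha>. complex_of_real (- \<alpha> / pi\<^sup>2) ^ m)"
  proof (rule landau_o.smallI)
    fix c :: real assume "c > 0"
    hence "c * pi\<^sup>2 > 0" by simp
    from eventually_at_right_0_less[OF this]
    show "\<forall>\<^sub>F \<alpha> in at_right 0. norm (complex_of_real (- \<alpha> / pi\<^sup>2) ^ Suc m) \<le> c * norm (complex_of_real (- \<alpha> / pi\<^sup>2) ^ m)"
    proof eventually_elim
      case (elim \<alpha>)
      hence "norm (complex_of_real (- \<alpha> / pi\<^sup>2)) \<le> c"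
        unfolding norm_of_real by (simp add: field_simps)
      thus ?case unfolding power_Suc norm_mult by (rule mult_right_mono) simp
    qed
  qed
next
  fix N :: nat
  define g where "g \<alpha> = - z / complex_of_real (sqrt (pi * \<alpha>)) * exp (z\<^sup>2 / 4)" for \<alpha>
  define \<phi> where "\<phi> m \<alpha> = complex_of_real (- \<alpha> / pi\<^sup>2) ^ m" for m and \<alpha> :: real
  define c where "c m = riemann_zeta (of_nat (2 * m)) * Gamma (of_nat m + 1 / 2)
          * kummer_1F1 (of_nat m + 1 / 2) (3 / 2) (- z\<^sup>2 / 4)" for m
  define f where "f \<alpha> = (\<integral>x. gauss_sinh z (sqrt \<alpha> * x) / complex_of_real (exp (2 * pi * x) - 1) \<partial>lborel)" for \<alpha>
  obtain C where C: "C \<ge> 0" "\<And>N s. s > 0 \<Longrightarrow>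
    norm ((\<integral>x. gauss_sinh z (s * x) / of_real (exp (2 * pi * x) - 1) \<partial>lborel) -
      (z / 2 * kummer_1F1 1 (3 / 2) (z\<^sup>2 / 4) / of_real s +
        2 * (\<Sum>k<N. gauss_sinh_coeff z k * of_real (s ^ (2 * k + 1) * bose_integral (2 * k + 1))))) \<le>
    C * s ^ (2 * N + 1) * bose_integral (2 * N + 1)"
    using gauss_sinh_bose_integral_estimate by blast
  define K where "K = C * \<bar>bose_integral (2 * N + 1)\<bar>"
  have K: "K \<ge> 0" using C(1) by (simp add: K_def)
  have bound: "norm (f \<alpha> - g \<alpha> * (\<Sum>m\<le>N. c m * \<phi> m \<alpha>)) \<le> K * sqrt \<alpha> ^ (2 * N + 1)" if "\<alpha> > 0" for \<alpha>
  proof -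
    define s where "s = sqrt \<alpha>"
    have s: "s > 0" "\<alpha> = s\<^sup>2" using that by (auto simp: s_def)
    \<comment> \<open>The term m = 0 is the plain integral, and m = k + 1 with k < N are the
      \<open>N\<close> Taylor terms of the Bose part.\<close>
    have "g \<alpha> * (\<Sum>m\<le>N. c m * \<phi> m \<alpha>) = g \<alpha> * (c 0 * \<phi> 0 \<alpha>) + (\<Sum>k<N. g \<alpha> * (c (Suc k) * \<phi> (Suc k) \<alpha>))"
      by (simp only: sum.atMost_shift distrib_left sum_distrib_left)
    also have "\<dots> = z / 2 * kummer_1F1 1 (3 / 2) (z\<^sup>2 / 4) / of_real s +
        2 * (\<Sum>k<N. gauss_sinh_coeff z k * of_real (s ^ (2 * k + 1) * bose_integral (2 * k + 1)))"
      unfolding g_def c_def \<phi>_def s(2) expansion_term_0[OF s(1)] expansion_term_Suc[OF s(1)] sum_distrib_left ..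
    finally have "norm (f \<alpha> - g \<alpha> * (\<Sum>m\<le>N. c m * \<phi> m \<alpha>)) \<le> C * s ^ (2 * N + 1) * bose_integral (2 * N + 1)"
      using C(2)[OF s(1), of N] by (simp only: f_def s_def)
    also have "\<dots> \<le> C * s ^ (2 * N + 1) * \<bar>bose_integral (2 * N + 1)\<bar>"
      using C(1) s(1) by (intro mult_left_mono) simp_all
    also have "\<dots> = K * sqrt \<alpha> ^ (2 * N + 1)" by (simp only: K_def s_def mult_ac)
    finally show ?thesis .
  qed
  have smallo: "(\<lambda>\<alpha>. f \<alpha> - g \<alpha> * (\<Sum>m\<le>N. c m * \<phi> m \<alpha>)) \<in> o[at_right 0](\<lambda>\<alpha>. g \<alpha> * \<phi> N \<alpha>)"
  \<comment> \<open>For z = 0 the comparison function is 0, so the difference must vanish exactly;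
    it does because sinh 0 = 0.\<close>
  proof (cases "z = 0")
    case True
    thus ?thesis by (simp add: f_def g_def gauss_sinh_def)
  next
    case False
    define L where "L = norm z / sqrt pi * norm (exp (z\<^sup>2 / 4)) / pi ^ (2 * N)"
    have L: "L > 0" using False by (simp add: L_def)
    have g\<phi>: "norm (g \<alpha> * \<phi> N \<alpha>) = L * sqrt \<alpha> ^ (2 * N) / sqrt \<alpha>" if "\<alpha> > 0" for \<alpha>
      using that unfolding g_def \<phi>_def L_def norm_mult norm_divide norm_power norm_of_real
      by (simp add: real_sqrt_mult power_mult power_divide)
    show ?thesis
    proof (rule landau_o.smallI)
      fix d :: real assume d: "d > 0"
      \<comment> \<open>Below this threshold K alpha <= d L; \<open>K + 1\<close> keeps the divisor
        positive when \<open>K\<close> is 0.\<close>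
      have "d * L / (K + 1) > 0" using d L K by simp
      from eventually_at_right_0_less[OF this]
      show "\<forall>\<^sub>F \<alpha> in at_right 0. norm (f \<alpha> - g \<alpha> * (\<Sum>m\<le>N. c m * \<phi> m \<alpha>)) \<le> d * norm (g \<alpha> * \<phi> N \<alpha>)"
      proof eventually_elim
        case (elim \<alpha>)
        have "\<alpha> * (K + 1) \<le> d * L" using elim K by (simp add: field_simps)
        hence le: "K * \<alpha> \<le> d * L" using elim by (simp add: algebra_simps)
        have "K * sqrt \<alpha> ^ (2 * N + 1) = K * (sqrt \<alpha>)\<^sup>2 * (sqrt \<alpha> ^ (2 * N) / sqrt \<alpha>)"
          using elim by (simp add: power2_eq_square del: real_sqrt_mult_self)
        also have "\<dots> = K * \<alpha> * (sqrt \<alpha> ^ (2 * N) / sqrt \<alpha>)" using elim by simp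
        also have "\<dots> \<le> d * L * (sqrt \<alpha> ^ (2 * N) / sqrt \<alpha>)"
          using elim by (intro mult_right_mono le) simp
        also have "\<dots> = d * norm (g \<alpha> * \<phi> N \<alpha>)" using elim by (simp add: g\<phi>)
        finally show ?case using bound[of \<alpha>] elim by linarith
      qed
    qed
  qed
  define J where "J \<alpha> = (\<integral>x. complex_of_real (exp (- \<alpha> * x\<^sup>2)) * sinh (complex_of_real (sqrt \<alpha> * x) * z)
                / complex_of_real (exp (2 * pi * x) - 1) \<partial>lborel)" for \<alpha>
  \<comment> \<open>The integrands are identified through (sqrt alpha)^2 = alpha, which needs alpha
    >= 0, so the equality is stated along the filter only.\<close>
  have eq: "\<forall>\<^sub>F \<alpha> in at_right 0. f \<alpha> - g \<alpha> * (\<Sum>m\<le>N. c m * \<phi> m \<alpha>) = J \<alpha> - g \<alpha> * (\<Sum>m\<le>N. c m * \<phi> m \<alpha>)"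
    using eventually_at_right_0_less[OF zero_less_one]
    by eventually_elim (simp add: f_def J_def gauss_sinh_def power_mult_distrib)
  have "(\<lambda>\<alpha>. J \<alpha> - g \<alpha> * (\<Sum>m\<le>N. c m * \<phi> m \<alpha>)) \<in> o[at_right 0](\<lambda>\<alpha>. g \<alpha> * \<phi> N \<alpha>)"
    using smallo by (rule landau_o.small.in_cong[OF eq, THEN iffD1])
  thus "(\<lambda>\<alpha>. (\<integral>x. complex_of_real (exp (- \<alpha> * x\<^sup>2)) * sinh (complex_of_real (sqrt \<alpha> * x) * z)
                / complex_of_real (exp (2 * pi * x) - 1) \<partial>lborel) -
      - z / complex_of_real (sqrt (pi * \<alpha>)) * exp (z\<^sup>2 / 4) *
      (\<Sum>m\<le>N. riemann_zeta (of_nat (2 * m)) * Gamma (of_nat m + 1 / 2)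
          * kummer_1F1 (of_nat m + 1 / 2) (3 / 2) (- z\<^sup>2 / 4) * complex_of_real (- \<alpha> / pi\<^sup>2) ^ m))
    \<in> o[at_right 0](\<lambda>\<alpha>. - z / complex_of_real (sqrt (pi * \<alpha>)) * exp (z\<^sup>2 / 4) * complex_of_real (- \<alpha> / pi\<^sup>2) ^ N)"
    unfolding J_def g_def c_def \<phi>_def .
qed

end
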